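(* Let $G$ be a connected locally finite graph with $D:=\mathrm{DN}_{\mathrm{LLY}}(G)<\infty$, and suppose that $G\neq C_n$ (cycle of length $n$) for every $n\ge6$. Then every nontrivial component $T$ of $\mathcal S(G)$ satisfies $$|B(T)|\le\lceil D\rceil .$$ If $T$ is infinite, then it is either a double ray or a one-ended tree obtained from a finite tree by attaching a degree-two ray.
   Context: Graphs are simple and undirected, possibly infinite. Let $d(\cdot,\cdot)$ be the combinatorial graph distance. For a positive edge weight $w:E\to(0,\infty)$ put $d_x^w:=\sum_{y\sim x}w_{xy}$. For $\alpha\in[0,1]$ let $\mu_x^{\alpha,w}$ be the probability measure with $\mu_x^{\alpha,w}(x)=\alpha$, $\mu_x^{\alpha,w}(z)=(1-\alpha)w_{xz}/d_x^w$ for $z\sim x$, and $0$ otherwise. Let $W_1$ be the $1$-Wasserstein distance with respect to $d$. For $x\sim y$ let $\kappa_\alpha^w(x,y):=1-W_1(\mu_x^{\alpha,w},\mu_y^{\alpha,w})$ and define the weighted Lin--Lu--Yau curvature $\kappa_{\mathrm{LLY}}^w(x,y):=\lim_{\alpha\to1^-}\kappa_\alpha^w(x,y)/(1-\alpha)$. For connected locally finite $G$ with $E\neq\varnothing$: $\mathrm{Dist}(w):=\sup_{e\in E}w_e/\inf_{e\in E}w_e$, with value $+\infty$ if the supremum is infinite or the infimum is $0$; a positive weight $w$ is admissible if $\kappa_{\mathrm{LLY}}^w(e)\ge0$ for every $e\in E$; and $\mathrm{DN}_{\mathrm{LLY}}(G):=\inf\{\mathrm{Dist}(w): w \text{ admissible}\}$,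 with value $+\infty$ if no admissible weight has finite distortion. By convention $\mathrm{DN}_{\mathrm{LLY}}(K_1)=1$. An edge is tree-like in $G$ if it lies on no cycle of $G$ of length $3$, $4$ or $5$; $E_{\mathrm{tl}}(G)$ is the set of tree-like edges, and $\mathcal S(G):=(V,E_{\mathrm{tl}}(G))$. A component of $\mathcal S(G)$ is nontrivial if it contains an edge. $B(T)$ is the set of vertices of degree at least $3$ in $T$. A ray is a one-way infinite simple path $v_0v_1v_2\cdots$; a double ray is a two-way infinite simple path indexed by $\mathbb Z$. A ray in $T$ is a degree-two ray if all its vertices have degree $2$ in $T$. Two rays determine the same end if for every finite vertex set $S$ sufficiently long tails of both lie in the same component of the graph minus $S$; a tree is one-ended if it has exactly one end. "Obtained from a finite tree $K$ by attaching a degree-two ray" means: $T$ is the disjoint union of a finite tree $K$ (possibly a single vertex) and a ray $R$, together with one edge joining a vertex of $K$ to the initial vertex of $R$, so that all vertices of $R$ have degree $2$ in $T$. *)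

theory Defs
  imports "HOL-Probability.Probability"
begin

section \<open>Simple undirected graphs, possibly infinite\<close>

record 'a graph =
  verts :: "'a set"
  edges :: "'a set set"

definition simple_graph :: "'a graph \<Rightarrow> bool" where
  "simple_graph G \<longleftrightarrow> (\<forall>e\<in>edges G. e \<subseteq> verts G \<and> card e = 2)"

definition adj :: "'a graph \<Rightarrow> 'a \<Rightarrow> 'a \<Rightarrow> bool" where
  "adj G x y \<longleftrightarrow> {x, y} \<in> edges G"

definition nbhd :: "'a graph \<Rightarrow> 'a \<Rightarrow> 'a set" where
  "nbhd G x = {y. adj G x y}"

definition locally_finite :: "'a graph \<Rightarrow> bool" where
  "locally_finite G \<longleftrightarrow> (\<forall>x\<in>verts G. finite (nbhd G x))"

text \<open>Only meaningful at vertices with finitely many neighbours.\<close>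

definition vertex_degree :: "'a graph \<Rightarrow> 'a \<Rightarrow> nat" where
  "vertex_degree G x = card (nbhd G x)"

definition walk :: "'a graph \<Rightarrow> 'a \<Rightarrow> 'a list \<Rightarrow> 'a \<Rightarrow> bool" where
  "walk G x p y \<longleftrightarrow>
     p \<noteq> [] \<and> set p \<subseteq> verts G \<and> successively (adj G) p \<and> hd p = x \<and> last p = y"

definition reachable :: "'a graph \<Rightarrow> 'a \<Rightarrow> 'a \<Rightarrow> bool" where
  "reachable G x y \<longleftrightarrow> (\<exists>p. walk G x p y)"

definition connected_graph :: "'a graph \<Rightarrow> bool" where
  "connected_graph G \<longleftrightarrow>
     verts G \<noteq> {} \<and> (\<forall>x\<in>verts G. \<forall>y\<in>verts G. reachable G x y)"

text \<open>Only meaningful for vertices joined by a walk. A walk with \<open>n\<close> edges lists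
  \<open>n + 1\<close> vertices.\<close>

definition graph_dist :: "'a graph \<Rightarrow> 'a \<Rightarrow> 'a \<Rightarrow> nat" where
  "graph_dist G x y = (LEAST n. \<exists>p. walk G x p y \<and> length p = Suc n)"

definition component_of :: "'a graph \<Rightarrow> 'a \<Rightarrow> 'a graph" where
  "component_of G x =
     \<lparr>verts = {y. reachable G x y}, edges = {e \<in> edges G. e \<subseteq> {y. reachable G x y}}\<rparr>"

definition graph_components :: "'a graph \<Rightarrow> 'a graph set" where
  "graph_components G = component_of G ` verts G"

definition remove_verts :: "'a graph \<Rightarrow> 'a set \<Rightarrow> 'a graph" where
  "remove_verts G S = \<lparr>verts = verts G - S, edges = {e \<in> edges G. e \<inter> S = {}}\<rparr>"

text \<open>A cycle is given by the list of its vertices, without repetition of the first one.\<close>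

definition is_cycle :: "'a graph \<Rightarrow> 'a list \<Rightarrow> bool" where
  "is_cycle G c \<longleftrightarrow> 3 \<le> length c \<and> distinct c \<and>
     (\<forall>i<length c. adj G (c ! i) (c ! (Suc i mod length c)))"

definition cycle_edges :: "'a list \<Rightarrow> 'a set set" where
  "cycle_edges c = {{c ! i, c ! (Suc i mod length c)} | i. i < length c}"

definition is_tree :: "'a graph \<Rightarrow> bool" where
  "is_tree G \<longleftrightarrow> simple_graph G \<and> connected_graph G \<and> (\<nexists>c. is_cycle G c)"

definition graph_iso :: "'a graph \<Rightarrow> 'b graph \<Rightarrow> bool" where
  "graph_iso G H \<longleftrightarrow>
     (\<exists>f. bij_betw f (verts G) (verts H) \<and> edges H = (\<lambda>e. f ` e) ` edges G)"

definition cycle_graph :: "nat \<Rightarrow> nat graph" where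
  "cycle_graph n = \<lparr>verts = {..<n}, edges = {{i, Suc i mod n} | i. i < n}\<rparr>"


section \<open>Weighted Lin--Lu--Yau curvature\<close>

text \<open>A weight is a function on unordered pairs; its values outside \<open>edges G\<close> are irrelevant.\<close>

definition wdegree :: "'a graph \<Rightarrow> ('a set \<Rightarrow> real) \<Rightarrow> 'a \<Rightarrow> real" where
  "wdegree G w x = (\<Sum>y\<in>nbhd G x. w {x, y})"

definition lazy_measure :: "'a graph \<Rightarrow> ('a set \<Rightarrow> real) \<Rightarrow> real \<Rightarrow> 'a \<Rightarrow> 'a pmf" where
  "lazy_measure G w \<alpha> x =
     embed_pmf (\<lambda>z. if z = x then \<alpha>
                    else if adj G x z then (1 - \<alpha>) * w {x, z} / wdegree G w x
                    else 0)"

lemma pmf_lazy_measure: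
  assumes "simple_graph G" and fin: "finite (nbhd G x)" and ne: "nbhd G x \<noteq> {}"
    and w: "\<And>e. e \<in> edges G \<Longrightarrow> w e > 0" and \<alpha>: "0 \<le> \<alpha>" "\<alpha> \<le> 1"
  shows "pmf (lazy_measure G w \<alpha> x) z =
           (if z = x then \<alpha>
            else if adj G x z then (1 - \<alpha>) * w {x, z} / wdegree G w x
            else 0)"
proof -
  let ?f = "\<lambda>z. if z = x then \<alpha>
              else if adj G x z then (1 - \<alpha>) * w {x, z} / wdegree G w x else 0"
  have x: "x \<notin> nbhd G x"
    using assms(1) by (auto simp: nbhd_def adj_def simple_graph_def)
  have d: "wdegree G w x > 0"
    unfolding wdegree_def using fin ne w by (intro sum_pos) (auto simp: nbhd_def adj_def)
  have nonneg: "0 \<le> ?f z" for z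
    using \<alpha> d w[of "{x, z}"] by (auto simp: adj_def intro!: divide_nonneg_pos mult_nonneg_nonneg)
  have "(\<integral>\<^sup>+z. ennreal (?f z) \<partial>count_space UNIV) =
          (\<Sum>z\<in>insert x (nbhd G x). ennreal (?f z))"
    using fin by (intro nn_integral_count_space'[OF finite.insertI]) (auto simp: nbhd_def)
  also have "\<dots> = ennreal (\<Sum>z\<in>insert x (nbhd G x). ?f z)"
    by (intro sum_ennreal nonneg)
  also have "(\<Sum>z\<in>insert x (nbhd G x). ?f z) =
               \<alpha> + (\<Sum>z\<in>nbhd G x. (1 - \<alpha>) * w {x, z} / wdegree G w x)"
    using fin x by (simp, intro sum.cong) (auto simp: nbhd_def)
  also have "\<dots> = \<alpha> + (1 - \<alpha>) * wdegree G w x / wdegree G w x"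
    by (simp add: wdegree_def sum_divide_distrib sum_distrib_left)
  also have "\<dots> = 1" using d by simp
  finally have "(\<integral>\<^sup>+z. ennreal (?f z) \<partial>count_space UNIV) = 1" by simp
  then show ?thesis
    unfolding lazy_measure_def by (intro pmf_embed_pmf nonneg)
qed

text \<open>The Bochner expectation is the transport cost because it is only used for measures of
  finite support, so every cost function is integrable.\<close>

definition wasserstein1 :: "('a \<Rightarrow> 'a \<Rightarrow> real) \<Rightarrow> 'a pmf \<Rightarrow> 'a pmf \<Rightarrow> real" where
  "wasserstein1 d p q =
     Inf {measure_pmf.expectation \<pi> (\<lambda>(u, v). d u v) | \<pi>.
            map_pmf fst \<pi> = p \<and> map_pmf snd \<pi> = q}"

definition kappa :: "'a graph \<Rightarrow> ('a set \<Rightarrow> real) \<Rightarrow> real \<Rightarrow> 'a \<Rightarrow> 'a \<Rightarrow> real" where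
  "kappa G w \<alpha> x y =
     1 - wasserstein1 (\<lambda>u v. real (graph_dist G u v))
           (lazy_measure G w \<alpha> x) (lazy_measure G w \<alpha> y)"

definition kappa_LLY :: "'a graph \<Rightarrow> ('a set \<Rightarrow> real) \<Rightarrow> 'a \<Rightarrow> 'a \<Rightarrow> real" where
  "kappa_LLY G w x y = Lim (at_left 1) (\<lambda>\<alpha>. kappa G w \<alpha> x y / (1 - \<alpha>))"

definition admissible :: "'a graph \<Rightarrow> ('a set \<Rightarrow> real) \<Rightarrow> bool" where
  "admissible G w \<longleftrightarrow>
     (\<forall>e\<in>edges G. w e > 0) \<and> (\<forall>x y. adj G x y \<longrightarrow> kappa_LLY G w x y \<ge> 0)"

definition distortion :: "'a graph \<Rightarrow> ('a set \<Rightarrow> real) \<Rightarrow> ereal" where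
  "distortion G w =
     (let M = (SUP e\<in>edges G. ereal (w e)); m = (INF e\<in>edges G. ereal (w e))
      in if M = \<infinity> \<or> m = 0 then \<infinity> else M / m)"

text \<open>The infimum of the empty set is \<open>\<infinity>\<close> in \<^typ>\<open>ereal\<close>. A connected graph
  without edges is a single vertex.\<close>

definition DN_LLY :: "'a graph \<Rightarrow> ereal" where
  "DN_LLY G = (if edges G = {} then 1 else (INF w\<in>{w. admissible G w}. distortion G w))"


section \<open>Tree-like edges, rays and ends\<close>

definition tree_like :: "'a graph \<Rightarrow> 'a set \<Rightarrow> bool" where
  "tree_like G e \<longleftrightarrow> e \<in> edges G \<and>
     (\<nexists>c. is_cycle G c \<and> length c \<in> {3, 4, 5} \<and> e \<in> cycle_edges c)"

definition tree_like_subgraph :: "'a graph \<Rightarrow> 'a graph" where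
  "tree_like_subgraph G = \<lparr>verts = verts G, edges = {e. tree_like G e}\<rparr>"

definition nontrivial :: "'a graph \<Rightarrow> bool" where
  "nontrivial T \<longleftrightarrow> edges T \<noteq> {}"

definition branch_verts :: "'a graph \<Rightarrow> 'a set" where
  "branch_verts T = {v \<in> verts T. vertex_degree T v \<ge> 3}"

definition ray :: "'a graph \<Rightarrow> (nat \<Rightarrow> 'a) \<Rightarrow> bool" where
  "ray G r \<longleftrightarrow> inj r \<and> range r \<subseteq> verts G \<and> (\<forall>i. adj G (r i) (r (Suc i)))"

definition degree_two_ray :: "'a graph \<Rightarrow> (nat \<Rightarrow> 'a) \<Rightarrow> bool" where
  "degree_two_ray G r \<longleftrightarrow> ray G r \<and> (\<forall>i. vertex_degree G (r i) = 2)"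

definition is_double_ray :: "'a graph \<Rightarrow> bool" where
  "is_double_ray T \<longleftrightarrow>
     (\<exists>f :: int \<Rightarrow> 'a. inj f \<and> verts T = range f \<and> edges T = {{f i, f (i + 1)} | i. True})"

definition same_end :: "'a graph \<Rightarrow> (nat \<Rightarrow> 'a) \<Rightarrow> (nat \<Rightarrow> 'a) \<Rightarrow> bool" where
  "same_end G r s \<longleftrightarrow>
     (\<forall>S. finite S \<and> S \<subseteq> verts G \<longrightarrow>
        (\<exists>C\<in>graph_components (remove_verts G S). \<exists>N. \<forall>n\<ge>N. r n \<in> verts C \<and> s n \<in> verts C))"

definition graph_ends :: "'a graph \<Rightarrow> (nat \<Rightarrow> 'a) set set" where
  "graph_ends G = {r. ray G r} // {(r, s). ray G r \<and> ray G s \<and> same_end G r s}"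

definition one_ended :: "'a graph \<Rightarrow> bool" where
  "one_ended G \<longleftrightarrow> (\<exists>\<omega>. graph_ends G = {\<omega>})"

definition finite_tree_with_ray :: "'a graph \<Rightarrow> bool" where
  "finite_tree_with_ray T \<longleftrightarrow>
     (\<exists>K r k. is_tree K \<and> finite (verts K) \<and> k \<in> verts K \<and>
        inj r \<and> verts K \<inter> range r = {} \<and>
        verts T = verts K \<union> range r \<and>
        edges T = edges K \<union> {{k, r 0}} \<union> {{r i, r (Suc i)} | i. True} \<and>
        degree_two_ray T r)"

end

theory Submission
  imports Defs
begin

text \<open>
  On a tree-like edge \<open>xy\<close> nonnegative curvature says \<open>w\<^sub>x\<^sub>y / d\<^sub>x + w\<^sub>x\<^sub>y / d\<^sub>y \<ge> 1\<close>, that is,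
  \<open>(d\<^sub>x - w\<^sub>x\<^sub>y) (d\<^sub>y - w\<^sub>x\<^sub>y) \<le> w\<^sub>x\<^sub>y\<^sup>2\<close>. Summing the first form around a cycle of tree-like edges forces all
  its vertices to have degree two in \<open>G\<close>, so that \<open>G\<close> is this cycle; otherwise the components of the
  tree-like subgraph are trees.

  To count branch vertices, normalise the weight to \<open>w \<ge> 1\<close> and root a finite subtree containing them
  at an end of its heaviest edge. Every vertex \<open>v\<close> other than the root sends at least half of its
  weight to its parent, and the second form shows that the remaining weight at \<open>v\<close> is at least the sum
  of the remaining weights at its children, plus \<open>2\<close> if \<open>v\<close> is a branch vertex. Comparing with the
  heaviest edge at the root gives \<open>|B| \<le> Dist(w) + 3/4\<close> for every admissible \<open>w\<close>, hence for the infimum,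
  and the ceiling absorbs the \<open>3/4\<close>.

  Along a ray of tree-like edges the second form makes weights decay geometrically unless each edge
  dominates the rest of the weight at its initial vertex. On a double ray this holds in both
  directions, so all vertices have degree two in \<open>G\<close> and the double ray is a whole component. If an
  infinite component contains no double ray, cutting off a tail of a ray behind the last branch vertex
  leaves a finite tree, since otherwise Koenig's lemma would provide a second ray.
\<close>

section \<open>Curvature of tree-like edges\<close>

lemma adj_commute: "adj G x y \<longleftrightarrow> adj G y x"
  by (simp add: adj_def insert_commute)

lemma simple_graph_adjD:
  assumes "simple_graph G" "adj G x y"
  shows "x \<in> verts G" "y \<in> verts G" "x \<noteq> y"
  using assms by (auto simp: simple_graph_def adj_def)

lemma finite_nbhd:
  assumes "simple_graph G" "locally_finite G"
  shows "finite (nbhd G x)"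
proof (cases "x \<in> verts G")
  case True
  then show ?thesis using assms(2) by (simp add: locally_finite_def)
next
  case False
  then have "nbhd G x = {}" using simple_graph_adjD(1)[OF assms(1)] by (auto simp: nbhd_def)
  then show ?thesis by simp
qed

lemma simple_graph_edgeE:
  assumes "simple_graph G" "e \<in> edges G"
  obtains x y where "e = {x, y}" "x \<noteq> y" "adj G x y"
proof -
  from assms have "card e = 2" by (auto simp: simple_graph_def)
  then show ?thesis using that assms(2) by (auto simp: card_2_iff adj_def)
qed

section \<open>Small graph distances and short cycles through a tree-like edge\<close>

lemma graph_dist_walk:
  assumes "reachable G x y"
  obtains p where "walk G x p y" "length p = Suc (graph_dist G x y)"
proof -
  from assms obtain q where q: "walk G x q y" by (auto simp: reachable_def)
  then have "q \<noteq> []" by (simp add: walk_def)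
  with q have "\<exists>n. \<exists>p. walk G x p y \<and> length p = Suc n"
    by (metis length_Suc_conv neq_Nil_conv)
  then have "\<exists>p. walk G x p y \<and> length p = Suc (graph_dist G x y)"
    unfolding graph_dist_def by (rule LeastI_ex)
  with that show ?thesis by blast
qed

lemma graph_dist_eq_0D:
  assumes "reachable G x y" "graph_dist G x y = 0"
  shows "x = y"
proof -
  obtain p where "walk G x p y" "length p = Suc (graph_dist G x y)"
    using graph_dist_walk[OF assms(1)] .
  with assms(2) show ?thesis by (auto simp: walk_def length_Suc_conv)
qed

lemma graph_dist_eq_1D:
  assumes "reachable G x y" "graph_dist G x y = 1"
  shows "adj G x y"
proof -
  obtain p where "walk G x p y" "length p = Suc (graph_dist G x y)"
    using graph_dist_walk[OF assms(1)] .
  with assms(2) show ?thesis by (auto simp: walk_def length_Suc_conv)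
qed

lemma graph_dist_eq_2D:
  assumes "reachable G x y" "graph_dist G x y = 2"
  shows "\<exists>z. adj G x z \<and> adj G z y"
proof -
  obtain p where "walk G x p y" "length p = Suc (graph_dist G x y)"
    using graph_dist_walk[OF assms(1)] .
  with assms(2) show ?thesis by (auto simp: walk_def length_Suc_conv numeral_2_eq_2)
qed

lemma tree_like_subgraph_adj: "adj (tree_like_subgraph G) x y \<longleftrightarrow> tree_like G {x, y}"
  by (simp add: tree_like_subgraph_def adj_def)

lemma tree_like_adj: "tree_like G {x, y} \<Longrightarrow> adj G x y"
  by (simp add: tree_like_def adj_def)

text \<open>The bounds are in successor form because \<open>length\<close> of an explicit list
  simplifies to it; the three parts serve cycles of length 3, 4 and 5.\<close>

lemma all_less_Suc_numeral:
  fixes P :: "nat \<Rightarrow> bool"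
  shows "(\<forall>i<Suc (Suc (Suc 0)). P i) \<longleftrightarrow> P 0 \<and> P 1 \<and> P 2"
    "(\<forall>i<Suc (Suc (Suc (Suc 0))). P i) \<longleftrightarrow> P 0 \<and> P 1 \<and> P 2 \<and> P 3"
    "(\<forall>i<Suc (Suc (Suc (Suc (Suc 0)))). P i) \<longleftrightarrow> P 0 \<and> P 1 \<and> P 2 \<and> P 3 \<and> P 4"
  by (auto simp: numeral_eq_Suc All_less_Suc)

lemma tree_like_no_triangle:
  assumes "simple_graph G" "tree_like G {x, y}" "adj G y u" "adj G u x"
  shows False
proof -
  have xy: "adj G x y" using assms(2) by (rule tree_like_adj)
  have "is_cycle G [x, y, u]"
    using assms xy simple_graph_adjD(3)[OF assms(1)] by (auto simp: is_cycle_def all_less_Suc_numeral)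
  moreover have "{x, y} \<in> cycle_edges [x, y, u]"
    unfolding cycle_edges_def by (rule CollectI, rule exI[of _ 0]) auto
  ultimately show False using assms(2) by (auto simp: tree_like_def)
qed

text \<open>Adjacent vertices of a simple graph differ, so only the nonconsecutive pairs of the
  would-be cycle are assumed distinct, here and for length 5.\<close>

lemma tree_like_no_4cycle:
  assumes "simple_graph G" "tree_like G {x, y}" "adj G y v" "adj G v u" "adj G u x"
    "v \<noteq> x" "u \<noteq> y"
  shows False
proof -
  have xy: "adj G x y" using assms(2) by (rule tree_like_adj)
  have "is_cycle G [x, y, v, u]"
    using assms xy simple_graph_adjD(3)[OF assms(1)] by (auto simp: is_cycle_def all_less_Suc_numeral)
  moreover have "{x, y} \<in> cycle_edges [x, y, v, u]"
    unfolding cycle_edges_def by (rule CollectI, rule exI[of _ 0]) auto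
  ultimately show False using assms(2) by (auto simp: tree_like_def)
qed

lemma tree_like_no_5cycle:
  assumes "simple_graph G" "tree_like G {x, y}" "adj G y v" "adj G v z" "adj G z u" "adj G u x"
    "v \<noteq> x" "u \<noteq> y" "z \<noteq> x" "z \<noteq> y" "u \<noteq> v"
  shows False
proof -
  have xy: "adj G x y" using assms(2) by (rule tree_like_adj)
  have "is_cycle G [x, y, v, z, u]"
    using assms xy simple_graph_adjD(3)[OF assms(1)] by (auto simp: is_cycle_def all_less_Suc_numeral)
  moreover have "{x, y} \<in> cycle_edges [x, y, v, z, u]"
    unfolding cycle_edges_def by (rule CollectI, rule exI[of _ 0]) auto
  ultimately show False using assms(2) by (auto simp: tree_like_def)
qed

text \<open>The Kantorovich potential is given by two functions, one for each ball: only pairs of points of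
  the two supports have to be compared, and no common Lipschitz extension is needed.\<close>

lemma tree_like_test_functions:
  assumes G: "simple_graph G" "connected_graph G" and tl: "tree_like G {x, y}"
    and u: "u = x \<or> adj G x u" and v: "v = y \<or> adj G y v"
  shows "(if v = y then 1 else if v = x then 0 else (2::real))
           - (if u = x then 0 else if u = y then 1 else - 1) \<le> real (graph_dist G u v)"
proof -
  note irr = simple_graph_adjD(3)[OF G(1)]
  have xy: "adj G x y" using tl by (rule tree_like_adj)
  have "u \<in> verts G" "v \<in> verts G"
    using u v xy simple_graph_adjD(1,2)[OF G(1)] by blast+
  then have r: "reachable G u v" using G(2) by (simp add: connected_graph_def)
  note D = graph_dist_eq_0D[OF r] graph_dist_eq_1D[OF r] graph_dist_eq_2D[OF r]
  have tri: "\<not> (adj G y z \<and> adj G z x)" for z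
    using tree_like_no_triangle[OF G(1) tl] by blast
  have c4: "\<not> (adj G y a \<and> adj G a b \<and> adj G b x)" if "a \<noteq> x" "b \<noteq> y" for a b
    using tree_like_no_4cycle[OF G(1) tl] that by blast
  have sym: "adj G a b \<Longrightarrow> adj G b a" for a b by (simp add: adj_commute)
  have cases3: "graph_dist G u v = 0 \<or> graph_dist G u v = 1 \<or> graph_dist G u v = 2 \<or> graph_dist G u v \<ge> 3"
    by linarith
  consider "u = x" "v = y" | "u = x" "v = x" | "u = x" "adj G y v" "v \<noteq> x" "v \<noteq> y"
    | "u = y" | "adj G x u" "u \<noteq> y" "u \<noteq> x" "v = y" | "v = x"
    | "adj G x u" "u \<noteq> y" "u \<noteq> x" "adj G y v" "v \<noteq> y" "v \<noteq> x"
    using u v by blast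
  then show ?thesis
  proof cases
    case 1
    then show ?thesis using D(1) irr[OF xy] by (cases "graph_dist G u v = 0") auto
  next
    case 2
    then show ?thesis using irr[OF xy] by simp
  next
    case 3
    have "graph_dist G u v \<noteq> 0" using D(1) 3 by auto
    moreover have "graph_dist G u v \<noteq> 1" using D(2) 3 tri sym by metis
    ultimately show ?thesis using 3 by auto
  next
    case 4
    have "graph_dist G u v \<noteq> 0" if "v \<noteq> y" using D(1) 4 that by auto
    then show ?thesis using 4 irr[OF xy] by auto
  next
    case 5
    have "graph_dist G u v \<noteq> 0" using D(1) 5 by auto
    moreover have "graph_dist G u v \<noteq> 1" using D(2) 5 tri sym by metis
    ultimately show ?thesis using 5 by auto
  next
    case 6
    have "graph_dist G u v \<noteq> 0" if "u \<noteq> x" using D(1) 6 that by auto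
    then show ?thesis using 6 irr[OF xy] by auto
  next
    \<comment> \<open>Both points are outer neighbours and the potentials differ by 3. Distance 0, 1
      or 2 would close a triangle, a 4-cycle or a triangle or 5-cycle through \<open>xy\<close>,
      respectively.\<close>
    case 7
    have "u \<noteq> v" using 7 tri sym by metis
    then have "graph_dist G u v \<noteq> 0" using D(1) by auto
    moreover have "graph_dist G u v \<noteq> 1" using D(2) 7 c4 sym by metis
    moreover have "graph_dist G u v \<noteq> 2"
    proof
      assume "graph_dist G u v = 2"
      then obtain z where z: "adj G u z" "adj G z v" using D(3) by blast
      have "z \<noteq> x" using z 7 tri sym by metis
      moreover have "z \<noteq> y" using z 7 tri sym by metis
      ultimately show False using tree_like_no_5cycle[OF G(1) tl, of v z u] z 7 \<open>u \<noteq> v\<close> sym by blast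
    qed
    ultimately have "graph_dist G u v \<ge> 3" using cases3 by linarith
    then show ?thesis using 7 by auto
  qed
qed

section \<open>Lazy measures and lower bounds for the Wasserstein distance\<close>

lemma pmf_lazy_measure_ball:
  assumes "simple_graph G" "finite (nbhd G x)" "nbhd G x \<noteq> {}"
    "\<forall>e\<in>edges G. w e > 0" "0 \<le> \<alpha>" "\<alpha> \<le> 1"
  shows "pmf (lazy_measure G w \<alpha> x) z =
           (if z = x then \<alpha>
            else if adj G x z then (1 - \<alpha>) * w {x, z} / wdegree G w x
            else 0)"
  using assms by (intro pmf_lazy_measure) auto

lemma expectation_lazy_measure:
  fixes f :: "'a \<Rightarrow> real"
  assumes "simple_graph G" "finite (nbhd G x)" "nbhd G x \<noteq> {}"
    "\<forall>e\<in>edges G. w e > 0" "0 \<le> \<alpha>" "\<alpha> \<le> 1"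
  shows "measure_pmf.expectation (lazy_measure G w \<alpha> x) f =
           \<alpha> * f x + (1 - \<alpha>) * (\<Sum>z\<in>nbhd G x. w {x, z} / wdegree G w x * f z)"
proof -
  note pmf = pmf_lazy_measure_ball[OF assms]
  have x: "x \<notin> nbhd G x" using simple_graph_adjD(3)[OF assms(1)] by (auto simp: nbhd_def)
  have "measure_pmf.expectation (lazy_measure G w \<alpha> x) f
      = (\<Sum>a\<in>insert x (nbhd G x). f a * pmf (lazy_measure G w \<alpha> x) a)"
    using assms(2) by (intro integral_measure_pmf_real)
      (auto simp: set_pmf_iff pmf nbhd_def split: if_splits)
  also have "\<dots> = f x * \<alpha> + (\<Sum>z\<in>nbhd G x. f z * pmf (lazy_measure G w \<alpha> x) z)"
    using assms(2) x by (simp add: pmf)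
  also have "(\<Sum>z\<in>nbhd G x. f z * pmf (lazy_measure G w \<alpha> x) z)
      = (\<Sum>z\<in>nbhd G x. (1 - \<alpha>) * (w {x, z} / wdegree G w x * f z))"
    using x by (intro sum.cong) (auto simp: pmf nbhd_def)
  finally show ?thesis by (simp add: sum_distrib_left mult.commute)
qed

lemma set_lazy_measure:
  assumes "simple_graph G" "finite (nbhd G x)" "nbhd G x \<noteq> {}"
    "\<forall>e\<in>edges G. w e > 0" "0 \<le> \<alpha>" "\<alpha> \<le> 1"
  shows "set_pmf (lazy_measure G w \<alpha> x) \<subseteq> insert x (nbhd G x)"
  using pmf_lazy_measure_ball[OF assms] by (auto simp: set_pmf_iff nbhd_def split: if_splits)

text \<open>The support lies in the product of the supports of the marginals. Finiteness makes every
  cost function integrable.\<close>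

lemma finite_set_coupling:
  assumes "finite (set_pmf (map_pmf fst \<pi>))" "finite (set_pmf (map_pmf snd \<pi>))"
  shows "finite (set_pmf \<pi>)"
  by (rule finite_subset[of _ "fst ` set_pmf \<pi> \<times> snd ` set_pmf \<pi>"]) (use assms in \<open>force+\<close>)

text \<open>The easy half of Kantorovich duality, with one potential per side: integrating
  \<open>g v - f u \<le> d u v\<close> against any coupling bounds its cost from below.\<close>

lemma wasserstein1_ge:
  assumes "finite (set_pmf p)" "finite (set_pmf q)"
    and le: "\<And>u v. u \<in> set_pmf p \<Longrightarrow> v \<in> set_pmf q \<Longrightarrow> g v - f u \<le> d u v"
  shows "measure_pmf.expectation q g - measure_pmf.expectation p f \<le> wasserstein1 d p q"
  unfolding wasserstein1_def
proof (rule cInf_greatest)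
  \<comment> \<open>The product coupling shows that the infimum is over a nonempty set.\<close>
  have "map_pmf fst (pair_pmf p q) = p \<and> map_pmf snd (pair_pmf p q) = q"
    by (simp add: map_fst_pair_pmf map_snd_pair_pmf)
  then show "{measure_pmf.expectation \<pi> (\<lambda>(u, v). d u v) |\<pi>. map_pmf fst \<pi> = p \<and> map_pmf snd \<pi> = q} \<noteq> {}"
    by blast
next
  fix c assume "c \<in> {measure_pmf.expectation \<pi> (\<lambda>(u, v). d u v) |\<pi>. map_pmf fst \<pi> = p \<and> map_pmf snd \<pi> = q}"
  then obtain \<pi> where c: "c = measure_pmf.expectation \<pi> (\<lambda>(u, v). d u v)"
    and \<pi>: "map_pmf fst \<pi> = p" "map_pmf snd \<pi> = q" by blast
  have fin: "finite (set_pmf \<pi>)" using finite_set_coupling[of \<pi>] assms(1,2) \<pi> by simp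
  note int = integrable_measure_pmf_finite[OF fin]
  have "measure_pmf.expectation q g - measure_pmf.expectation p f
      = measure_pmf.expectation \<pi> (\<lambda>z. g (snd z)) - measure_pmf.expectation \<pi> (\<lambda>z. f (fst z))"
    by (simp add: \<pi>[symmetric])
  also have "\<dots> = measure_pmf.expectation \<pi> (\<lambda>z. g (snd z) - f (fst z))"
    by (simp add: int)
  also have "\<dots> \<le> measure_pmf.expectation \<pi> (\<lambda>(u, v). d u v)"
  proof (rule integral_mono_AE[OF int int], rule AE_pmfI)
    fix z assume "z \<in> set_pmf \<pi>"
    then have "fst z \<in> set_pmf p" "snd z \<in> set_pmf q" using \<pi> by auto
    then show "g (snd z) - f (fst z) \<le> (case z of (u, v) \<Rightarrow> d u v)" using le by (simp add: case_prod_beta)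
  qed
  finally show "measure_pmf.expectation q g - measure_pmf.expectation p f \<le> c" by (simp add: c)
qed

text \<open>Write \<open>s\<close> for the sum of \<open>2 * w {x, y}\<close> divided by either
  degree. The expectations of the two test functions differ by
  \<open>\<alpha> + (1 - \<alpha>) * (3 - s)\<close>, and subtracting this from 1 leaves
  \<open>(1 - \<alpha>) * (s - 2)\<close>.\<close>

lemma kappa_tree_like_le:
  assumes G: "simple_graph G" "connected_graph G" "locally_finite G" and tl: "tree_like G {x, y}"
    and w: "\<forall>e\<in>edges G. w e > 0" and \<alpha>: "0 \<le> \<alpha>" "\<alpha> \<le> 1"
  shows "kappa G w \<alpha> x y
           \<le> (1 - \<alpha>) * (2 * w {x, y} / wdegree G w x + 2 * w {x, y} / wdegree G w y - 2)"
proof -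
  let ?f = "\<lambda>u. if u = x then 0 else if u = y then 1 else - 1 :: real"
  let ?g = "\<lambda>v. if v = y then 1 else if v = x then 0 else 2 :: real"
  have xy: "adj G x y" "adj G y x" using tl tree_like_adj[of G x y] by (auto simp: adj_commute)
  have N: "finite (nbhd G x)" "finite (nbhd G y)" using finite_nbhd[OF G(1,3)] by auto
  have ne: "y \<in> nbhd G x" "x \<in> nbhd G y" using xy by (auto simp: nbhd_def)
  then have N0: "nbhd G x \<noteq> {}" "nbhd G y \<noteq> {}" by auto
  have irr: "x \<notin> nbhd G x" "y \<notin> nbhd G y" "x \<noteq> y"
    using simple_graph_adjD(3)[OF G(1)] xy by (auto simp: nbhd_def)
  have d: "wdegree G w z > 0" if "finite (nbhd G z)" "nbhd G z \<noteq> {}" for z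
    unfolding wdegree_def using that w by (intro sum_pos) (auto simp: nbhd_def adj_def)
  have one: "(\<Sum>z\<in>nbhd G x. w {x, z} / wdegree G w x) = 1" "(\<Sum>z\<in>nbhd G y. w {y, z} / wdegree G w y) = 1"
    using d[OF N(1) N0(1)] d[OF N(2) N0(2)]
    by (simp_all add: sum_divide_distrib[symmetric] wdegree_def[symmetric])
  note S1 = set_lazy_measure[OF G(1) N(1) N0(1) w \<alpha>] and S2 = set_lazy_measure[OF G(1) N(2) N0(2) w \<alpha>]
  have W: "measure_pmf.expectation (lazy_measure G w \<alpha> y) ?g - measure_pmf.expectation (lazy_measure G w \<alpha> x) ?f
      \<le> wasserstein1 (\<lambda>u v. real (graph_dist G u v)) (lazy_measure G w \<alpha> x) (lazy_measure G w \<alpha> y)"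
  proof (rule wasserstein1_ge)
    show "finite (set_pmf (lazy_measure G w \<alpha> x))" "finite (set_pmf (lazy_measure G w \<alpha> y))"
      using finite_subset[OF S1] finite_subset[OF S2] N by auto
    fix u v assume "u \<in> set_pmf (lazy_measure G w \<alpha> x)" "v \<in> set_pmf (lazy_measure G w \<alpha> y)"
    then have "u = x \<or> adj G x u" "v = y \<or> adj G y v" using S1 S2 by (auto simp: nbhd_def)
    then show "?g v - ?f u \<le> real (graph_dist G u v)"
      by (rule tree_like_test_functions[OF G(1,2) tl])
  qed
  \<comment> \<open>On the neighbours of \<open>x\<close>, \<open>?f\<close> is -1 plus twice the
    indicator of \<open>y\<close>. Likewise \<open>?g\<close> is 2 minus twice the indicator of
    \<open>x\<close> on the neighbours of \<open>y\<close>.\<close>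
  have "(\<Sum>z\<in>nbhd G x. w {x, z} / wdegree G w x * ?f z)
      = (\<Sum>z\<in>nbhd G x. (if z = y then 2 * w {x, y} / wdegree G w x else 0) - w {x, z} / wdegree G w x)"
    using irr by (intro sum.cong) auto
  then have sx: "(\<Sum>z\<in>nbhd G x. w {x, z} / wdegree G w x * ?f z) = 2 * w {x, y} / wdegree G w x - 1"
    using N ne by (simp add: sum_subtractf one)
  have "(\<Sum>z\<in>nbhd G y. w {y, z} / wdegree G w y * ?g z)
      = (\<Sum>z\<in>nbhd G y. 2 * (w {y, z} / wdegree G w y) - (if z = x then 2 * w {x, y} / wdegree G w y else 0))"
    using irr by (intro sum.cong) (auto simp: insert_commute)
  then have sy: "(\<Sum>z\<in>nbhd G y. w {y, z} / wdegree G w y * ?g z) = 2 - 2 * w {x, y} / wdegree G w y"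
    using N ne by (simp add: sum_subtractf one sum_distrib_left[symmetric] del: times_divide_eq_right)
  show ?thesis
    using W unfolding kappa_def expectation_lazy_measure[OF G(1) N(1) N0(1) w \<alpha>]
      expectation_lazy_measure[OF G(1) N(2) N0(2) w \<alpha>] sx sy
    by (simp add: algebra_simps)
qed

section \<open>Dependence on the laziness and the limit defining the curvature\<close>

text \<open>The mass at \<open>x\<close> agrees because
  \<open>t * \<alpha> + (1 - t) = 1 - t * (1 - \<alpha>)\<close>; all other masses scale by
  \<open>t\<close>.\<close>

lemma lazy_measure_mix:
  assumes G: "simple_graph G" "finite (nbhd G x)" "nbhd G x \<noteq> {}" "\<forall>e\<in>edges G. w e > 0"
    and t: "0 \<le> t" "t \<le> 1" and \<alpha>: "0 \<le> \<alpha>" "\<alpha> \<le> 1"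
  shows "lazy_measure G w (1 - t * (1 - \<alpha>)) x =
           bind_pmf (bernoulli_pmf t) (\<lambda>b. if b then lazy_measure G w \<alpha> x else return_pmf x)"
proof (rule pmf_eqI)
  have "t * (1 - \<alpha>) \<le> 1" using t \<alpha> by (simp add: mult_le_one)
  then have b: "0 \<le> 1 - t * (1 - \<alpha>)" "1 - t * (1 - \<alpha>) \<le> 1" using t \<alpha> by auto
  show "pmf (lazy_measure G w (1 - t * (1 - \<alpha>)) x) z =
      pmf (bind_pmf (bernoulli_pmf t) (\<lambda>b. if b then lazy_measure G w \<alpha> x else return_pmf x)) z" for z
    unfolding pmf_lazy_measure_ball[OF G b]
    using t by (simp add: pmf_bind pmf_lazy_measure_ball[OF G \<alpha>] algebra_simps)
qed

text \<open>A nonnegative cost bounds the set of coupling costs from below, as the real infimum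
  requires.\<close>

lemma wasserstein1_le:
  assumes "\<And>u v. 0 \<le> d u v"
  shows "wasserstein1 d (map_pmf fst \<pi>) (map_pmf snd \<pi>) \<le> measure_pmf.expectation \<pi> (\<lambda>(u, v). d u v)"
  unfolding wasserstein1_def
  by (rule cInf_lower) (use assms in \<open>auto intro!: bdd_belowI[of _ 0] Bochner_Integration.integral_nonneg\<close>)

text \<open>Convexity of the transport cost. No optimal coupling is selected: the inequality is
  solved for \<open>wasserstein1 d p q\<close>, dividing by \<open>t\<close>, and checked against
  every coupling.\<close>

lemma wasserstein1_mix:
  assumes fin: "finite (set_pmf p)" "finite (set_pmf q)" and t: "0 < t" "t \<le> 1"
    and d: "\<And>u v. 0 \<le> d u v"
  shows "wasserstein1 d (bind_pmf (bernoulli_pmf t) (\<lambda>b. if b then p else return_pmf x))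
                        (bind_pmf (bernoulli_pmf t) (\<lambda>b. if b then q else return_pmf y))
           \<le> t * wasserstein1 d p q + (1 - t) * d x y"
    (is "?W \<le> _")
proof -
  have "(?W - (1 - t) * d x y) / t \<le> wasserstein1 d p q"
    unfolding wasserstein1_def[of d p q]
  proof (rule cInf_greatest)
    have "map_pmf fst (pair_pmf p q) = p \<and> map_pmf snd (pair_pmf p q) = q"
      by (simp add: map_fst_pair_pmf map_snd_pair_pmf)
    then show "{measure_pmf.expectation \<pi> (\<lambda>(u, v). d u v) |\<pi>. map_pmf fst \<pi> = p \<and> map_pmf snd \<pi> = q} \<noteq> {}"
      by blast
  next
    fix c assume "c \<in> {measure_pmf.expectation \<pi> (\<lambda>(u, v). d u v) |\<pi>. map_pmf fst \<pi> = p \<and> map_pmf snd \<pi> = q}"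
    then obtain \<pi> where c: "c = measure_pmf.expectation \<pi> (\<lambda>(u, v). d u v)"
      and \<pi>: "map_pmf fst \<pi> = p" "map_pmf snd \<pi> = q" by blast
    have f: "finite (set_pmf \<pi>)" using finite_set_coupling[of \<pi>] fin \<pi> by simp
    \<comment> \<open>One coin decides for both marginals between \<open>\<pi>\<close> and the point
      mass at \<open>(x, y)\<close>.\<close>
    define \<rho> where "\<rho> = bind_pmf (bernoulli_pmf t) (\<lambda>b. if b then \<pi> else return_pmf (x, y))"
    have "map_pmf fst \<rho> = bind_pmf (bernoulli_pmf t) (\<lambda>b. if b then p else return_pmf x)"
      unfolding \<rho>_def map_bind_pmf by (intro bind_pmf_cong) (auto simp: \<pi>)
    moreover have "map_pmf snd \<rho> = bind_pmf (bernoulli_pmf t) (\<lambda>b. if b then q else return_pmf y)"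
      unfolding \<rho>_def map_bind_pmf by (intro bind_pmf_cong) (auto simp: \<pi>)
    ultimately have "?W \<le> measure_pmf.expectation \<rho> (\<lambda>(u, v). d u v)"
      using wasserstein1_le[of d \<rho>] d by simp
    also have "\<dots> = t * c + (1 - t) * d x y"
      unfolding \<rho>_def c using f t by (subst pmf_expectation_bind[of UNIV]) (auto simp: UNIV_bool)
    finally show "(?W - (1 - t) * d x y) / t \<le> c" using t by (simp add: field_simps)
  qed
  then show ?thesis using t by (simp add: field_simps)
qed

lemma graph_dist_adj:
  assumes "simple_graph G" "adj G x y"
  shows "graph_dist G x y = 1"
proof -
  have w: "walk G x [x, y] y" using assms simple_graph_adjD[OF assms] by (auto simp: walk_def)
  then have "graph_dist G x y \<le> 1" unfolding graph_dist_def by (intro Least_le) auto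
  moreover have "graph_dist G x y \<noteq> 0"
    using graph_dist_eq_0D[of G x y] w simple_graph_adjD(3)[OF assms] by (auto simp: reachable_def)
  ultimately show ?thesis by simp
qed

text \<open>Mixing a coupling with the transport of the two Dirac masses makes the ratio monotone in the
  laziness; with an upper bound this gives the existence of the limit, without which the value of
  \<^const>\<open>Lim\<close> would be arbitrary.\<close>

lemma kappa_ratio_mono:
  assumes G: "simple_graph G" "locally_finite G" "adj G x y"
    and w: "\<forall>e\<in>edges G. w e > 0" and \<alpha>: "0 \<le> \<alpha>" "\<alpha> \<le> \<beta>" "\<beta> < 1"
  shows "kappa G w \<alpha> x y / (1 - \<alpha>) \<le> kappa G w \<beta> x y / (1 - \<beta>)"
proof -
  \<comment> \<open>The mixing parameter that turns laziness \<open>\<alpha>\<close> into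
    \<open>\<beta>\<close>.\<close>
  define t where "t = (1 - \<beta>) / (1 - \<alpha>)"
  have t: "0 < t" "t \<le> 1" and \<beta>: "\<beta> = 1 - t * (1 - \<alpha>)" using \<alpha> by (auto simp: t_def)
  have \<alpha>': "0 \<le> \<alpha>" "\<alpha> \<le> 1" using \<alpha> by auto
  have N: "finite (nbhd G x)" "finite (nbhd G y)" using finite_nbhd[OF G(1,2)] by auto
  have N0: "nbhd G x \<noteq> {}" "nbhd G y \<noteq> {}" using G(3) by (auto simp: nbhd_def adj_commute)
  have fin: "finite (set_pmf (lazy_measure G w \<alpha> x))" "finite (set_pmf (lazy_measure G w \<alpha> y))"
    using finite_subset[OF set_lazy_measure[OF G(1) N(1) N0(1) w \<alpha>']]
      finite_subset[OF set_lazy_measure[OF G(1) N(2) N0(2) w \<alpha>']] N by auto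
  \<comment> \<open>As \<open>x\<close> and \<open>y\<close> have distance 1, the Dirac part costs
    \<open>1 - t\<close>, and 1 minus the total cost is at least
    \<open>t * kappa G w \<alpha> x y\<close>.\<close>
  have "t * kappa G w \<alpha> x y \<le> kappa G w \<beta> x y"
    unfolding kappa_def \<beta> lazy_measure_mix[OF G(1) N(1) N0(1) w less_imp_le[OF t(1)] t(2) \<alpha>']
      lazy_measure_mix[OF G(1) N(2) N0(2) w less_imp_le[OF t(1)] t(2) \<alpha>']
    using wasserstein1_mix[OF fin t, of "\<lambda>u v. real (graph_dist G u v)" x y] graph_dist_adj[OF G(1,3)]
    unfolding right_diff_distrib by simp
  then show ?thesis using \<alpha> by (simp add: t_def field_simps)
qed

lemma kappa_LLY_tree_like_le:
  assumes G: "simple_graph G" "connected_graph G" "locally_finite G" and tl: "tree_like G {x, y}"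
    and w: "\<forall>e\<in>edges G. w e > 0"
  shows "kappa_LLY G w x y \<le> 2 * w {x, y} / wdegree G w x + 2 * w {x, y} / wdegree G w y - 2"
    (is "_ \<le> ?c")
proof -
  define h where "h = (\<lambda>\<alpha>. kappa G w \<alpha> x y / (1 - \<alpha>))"
  have xy: "adj G x y" using tl by (rule tree_like_adj)
  have le: "h \<alpha> \<le> ?c" if "0 < \<alpha>" "\<alpha> < 1" for \<alpha>
    unfolding h_def using kappa_tree_like_le[OF G tl w, of \<alpha>] that by (simp add: divide_le_eq mult.commute)
  have bdd: "bdd_above (h ` {0<..<1})" using le by (auto intro!: bdd_aboveI[of _ ?c])
  \<comment> \<open>Being increasing and bounded, \<open>h\<close> tends to its supremum from the
    left of 1.\<close>
  let ?l = "Sup (h ` {0<..<1})"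
  have int: "eventually (\<lambda>\<alpha>. \<alpha> \<in> {a<..<1}) (at_left 1)" if "a < 1" for a :: real
    using that by (rule eventually_at_left_real)
  have "(h \<longlongrightarrow> ?l) (at_left 1)"
  proof (rule increasing_tendsto)
    show "eventually (\<lambda>\<alpha>. h \<alpha> \<le> ?l) (at_left 1)"
      using int[OF zero_less_one] by (rule eventually_mono) (auto intro!: cSup_upper bdd)
  next
    fix b assume "b < ?l"
    then obtain \<alpha> where \<alpha>: "0 < \<alpha>" "\<alpha> < 1" "b < h \<alpha>"
      using less_cSup_iff[OF _ bdd, of b] by auto
    show "eventually (\<lambda>\<alpha>. b < h \<alpha>) (at_left 1)"
      using int[OF \<alpha>(2)]
    proof (rule eventually_mono)
      fix \<beta> assume "\<beta> \<in> {\<alpha><..<1}"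
      then have "h \<alpha> \<le> h \<beta>" unfolding h_def using \<alpha> by (intro kappa_ratio_mono[OF G(1,3) xy w]) auto
      then show "b < h \<beta>" using \<alpha> by simp
    qed
  qed
  then have "kappa_LLY G w x y = ?l"
    unfolding kappa_LLY_def h_def by (intro tendsto_Lim) auto
  also have "\<dots> \<le> ?c" using le by (intro cSup_least) auto
  finally show ?thesis .
qed

text \<open>Clear the positive denominators in the curvature bound and add the square of
  \<open>w {x, y}\<close> to both sides.\<close>

lemma admissible_tree_like:
  assumes G: "simple_graph G" "connected_graph G" "locally_finite G" and tl: "tree_like G {x, y}"
    and "admissible G w"
  shows "(wdegree G w x - w {x, y}) * (wdegree G w y - w {x, y}) \<le> (w {x, y})\<^sup>2"
proof -
  have w: "\<forall>e\<in>edges G. w e > 0" and "kappa_LLY G w x y \<ge> 0"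
    using assms(5) tree_like_adj[OF tl] by (auto simp: admissible_def)
  then have "0 \<le> 2 * w {x, y} / wdegree G w x + 2 * w {x, y} / wdegree G w y - 2"
    using kappa_LLY_tree_like_le[OF G tl w] by linarith
  moreover have d: "wdegree G w z > 0" if "nbhd G z \<noteq> {}" for z
    unfolding wdegree_def using that w finite_nbhd[OF G(1,3)] by (intro sum_pos) (auto simp: nbhd_def adj_def)
  have "wdegree G w x > 0" "wdegree G w y > 0"
    using tree_like_adj[OF tl] by (auto intro!: d simp: nbhd_def adj_commute)
  ultimately show ?thesis by (simp add: field_simps power2_eq_square)
qed

section \<open>Domination of weights along tree-like edges\<close>

text \<open>From here on curvature enters only through \<open>tree_like_ineq\<close>;
  \<open>w_ge_1\<close> is the normalisation of the weight.\<close>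

locale tree_like_weight =
  fixes G :: "'a graph" and w :: "'a set \<Rightarrow> real"
  assumes simple: "simple_graph G" and loc_fin: "locally_finite G"
    and w_ge_1: "e \<in> edges G \<Longrightarrow> 1 \<le> w e"
    and tree_like_ineq: "tree_like G {x, y} \<Longrightarrow>
      (wdegree G w x - w {x, y}) * (wdegree G w y - w {x, y}) \<le> (w {x, y})\<^sup>2"
begin

abbreviation F where "F \<equiv> tree_like_subgraph G"
abbreviation N where "N \<equiv> nbhd G"
abbreviation d where "d \<equiv> wdegree G w"

definition rest :: "'a \<Rightarrow> 'a \<Rightarrow> real" where
  "rest v u = d v - w {v, u}"

definition dominates :: "'a \<Rightarrow> 'a \<Rightarrow> bool" where
  "dominates v u \<longleftrightarrow> d v \<le> 2 * w {v, u}"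

lemma fin_N [simp]: "finite (N v)"
  using finite_nbhd[OF simple loc_fin] .

lemma N_ge_1: "u \<in> N v \<Longrightarrow> 1 \<le> w {v, u}"
  using w_ge_1 by (auto simp: nbhd_def adj_def)

lemma N_sym: "u \<in> N v \<longleftrightarrow> v \<in> N u"
  by (simp add: nbhd_def adj_commute)

lemma F_N: "adj F v u \<Longrightarrow> u \<in> N v"
  by (simp add: tree_like_subgraph_adj nbhd_def tree_like_adj)

lemma sum_le_d: "C \<subseteq> N v \<Longrightarrow> (\<Sum>c\<in>C. w {v, c}) \<le> d v"
  unfolding wdegree_def by (rule sum_mono2) (use N_ge_1 in force)+

lemma rest_eq: "u \<in> N v \<Longrightarrow> rest v u = (\<Sum>c\<in>N v - {u}. w {v, c})"
  by (simp add: rest_def wdegree_def sum_diff1)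

text \<open>The gap comes from \<open>w_ge_1\<close>: either \<open>u\<close> is the only neighbour
  of \<open>v\<close>, or another edge contributes at least 1.\<close>

lemma rest_zero_or_ge_1:
  assumes "u \<in> N v" shows "rest v u = 0 \<or> 1 \<le> rest v u"
proof (cases "N v - {u} = {}")
  case True
  then show ?thesis unfolding rest_eq[OF assms] True by simp
next
  case False
  then obtain c where c: "c \<in> N v - {u}" by blast
  have "1 \<le> w {v, c}" using c N_ge_1 by simp
  also have "\<dots> \<le> (\<Sum>c\<in>N v - {u}. w {v, c})"
    by (rule member_le_sum[OF c]) (use N_ge_1 in force)+
  finally show ?thesis using assms by (simp add: rest_eq)
qed

lemma rest_nonneg: "u \<in> N v \<Longrightarrow> 0 \<le> rest v u"
  using rest_zero_or_ge_1[of u v] by auto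

lemma rest_mult_le: "adj F v u \<Longrightarrow> rest v u * rest u v \<le> (w {v, u})\<^sup>2"
  using tree_like_ineq[of v u] by (simp add: tree_like_subgraph_adj rest_def insert_commute[of u v])

lemma rest_ge:
  assumes "u \<in> N v" "c \<in> N v" "c \<noteq> u"
  shows "w {v, c} \<le> rest v u"
  unfolding rest_eq[OF assms(1)] by (rule member_le_sum) (use assms N_ge_1 in force)+

lemma dom_iff_rest: "dominates v u \<longleftrightarrow> rest v u \<le> w {v, u}"
  by (auto simp: dominates_def rest_def)

text \<open>If both failed, both rests would exceed the weight of the edge, and their product its
  square.\<close>

lemma dom_total:
  assumes "adj F v u" shows "dominates v u \<or> dominates u v"
proof (rule ccontr)
  assume "\<not> (dominates v u \<or> dominates u v)"
  then have "w {v, u} < rest v u" "w {v, u} < rest u v"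
    by (auto simp: dom_iff_rest insert_commute)
  moreover have "0 < w {v, u}" using N_ge_1[OF F_N[OF assms]] by simp
  ultimately have "w {v, u} * w {v, u} < rest v u * rest u v" by (intro mult_strict_mono) auto
  with rest_mult_le[OF assms] show False by (simp add: power2_eq_square)
qed

text \<open>Domination spreads away from a dominating edge:
  \<open>w {v, c} \<le> rest v u \<le> w {v, u} \<le> rest v c\<close>, and then
  \<open>rest_mult_le\<close> on \<open>vc\<close> leaves at most \<open>w {v, c}\<close> for
  \<open>rest c v\<close>.\<close>

lemma dom_child:
  assumes "dominates v u" "u \<in> N v" "adj F c v" "c \<noteq> u"
  shows "dominates c v"
proof (rule ccontr)
  assume n: "\<not> dominates c v"
  have c: "c \<in> N v" using F_N[OF assms(3)] N_sym by simp
  have "w {v, c} \<le> rest v u" using rest_ge[OF assms(2) c assms(4)] .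
  then have "w {v, c} \<le> w {v, u}" using assms(1) by (simp add: dom_iff_rest)
  then have "w {v, c} \<le> rest v c" using rest_ge[OF c assms(2)] assms(4) by auto
  have "rest c v * rest v c \<le> w {v, c} * w {v, c}"
    using rest_mult_le[OF assms(3)] by (simp add: power2_eq_square insert_commute)
  also have "\<dots> \<le> w {v, c} * rest v c"
    using \<open>w {v, c} \<le> rest v c\<close> N_ge_1[OF c] by (intro mult_left_mono) auto
  finally have "rest c v \<le> w {v, c}"
    using \<open>w {v, c} \<le> rest v c\<close> N_ge_1[OF c] by (auto simp: mult_le_cancel_right)
  with n show False by (simp add: dom_iff_rest insert_commute)
qed

text \<open>Since \<open>vu\<close> dominates, the inequality on an edge \<open>vc\<close> bounds its weight from below in terms of
  \<open>rest c v\<close>, by one more than \<open>rest c v\<close> as soon as \<open>v\<close> has a third neighbour.\<close>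

lemma rest_recursion:
  assumes dominates: "dominates v u" and u: "u \<in> N v" and C: "C \<subseteq> {c. adj F c v} - {u}"
  shows "(if 3 \<le> card (N v) then 2 else 0) + (\<Sum>c\<in>C. rest c v) \<le> rest v u"
proof -
  have CN: "C \<subseteq> N v - {u}" using C F_N N_sym by blast
  \<comment> \<open>As \<open>vu\<close> dominates, \<open>rest v c\<close> is at least
    \<open>2 * rest v u - w {v, c}\<close>.\<close>
  have step: "rest c v * (2 * rest v u - w {v, c}) \<le> (w {v, c})\<^sup>2" if "c \<in> C" for c
  proof -
    have cN: "v \<in> N c" using CN that N_sym by auto
    have "rest c v * (2 * rest v u - w {v, c}) \<le> rest c v * rest v c"
      using dominates rest_nonneg[OF cN] by (intro mult_left_mono) (auto simp: rest_def dominates_def)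
    also have "\<dots> \<le> (w {v, c})\<^sup>2" using rest_mult_le[of c v] C that by (auto simp: insert_commute)
    finally show ?thesis .
  qed
  have wle: "w {v, c} \<le> rest v u" "1 \<le> w {v, c}" "rest c v = 0 \<or> 1 \<le> rest c v" if "c \<in> C" for c
    using rest_ge[OF u] N_ge_1 rest_zero_or_ge_1[of v c] N_sym CN that by (auto simp: subset_iff)
  show ?thesis
  proof (cases "3 \<le> card (N v)")
    case False
    have "rest c v \<le> w {v, c}" if c: "c \<in> C" for c
    proof -
      have "rest c v * w {v, c} \<le> rest c v * (2 * rest v u - w {v, c})"
        using wle[OF c] by (intro mult_left_mono) auto
      also have "\<dots> \<le> w {v, c} * w {v, c}" using step[OF c] by (simp add: power2_eq_square)
      finally show ?thesis using wle(2)[OF c] by (simp add: mult_le_cancel_right)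
    qed
    then have "(\<Sum>c\<in>C. rest c v) \<le> (\<Sum>c\<in>C. w {v, c})" by (rule sum_mono)
    also have "\<dots> \<le> rest v u" unfolding rest_eq[OF u]
      by (rule sum_mono2) (use CN N_ge_1 in force)+
    finally show ?thesis using False by simp
  next
    case True
    then have two: "2 \<le> card (N v - {u})" using u by simp
    \<comment> \<open>A third neighbour \<open>c'\<close> of \<open>v\<close> carries weight at
      least 1, so \<open>w {v, c} + 1 \<le> rest v u\<close>; this improves \<open>step\<close> by
      2.\<close>
    have le: "rest c v + 1 \<le> w {v, c}" if c: "c \<in> C" for c
    proof (cases "rest c v = 0")
      case True then show ?thesis using wle[OF c] by simp
    next
      case False
      then have r: "1 \<le> rest c v" using wle(3)[OF c] by simp
      have "\<not> N v - {u} \<subseteq> {c}" using two card_mono[of "{c}" "N v - {u}"] by auto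
      then obtain c' where c': "c' \<in> N v - {u}" "c' \<noteq> c" by blast
      have "w {v, c} + w {v, c'} = (\<Sum>c\<in>{c, c'}. w {v, c})" using c' by simp
      also have "\<dots> \<le> rest v u"
        unfolding rest_eq[OF u] by (rule sum_mono2) (use CN c c' N_ge_1 in force)+
      finally have "w {v, c} + 1 \<le> rest v u" using N_ge_1[of c' v] c' by auto
      then have "rest c v * (w {v, c} + 2) \<le> rest c v * (2 * rest v u - w {v, c})"
        using r by (intro mult_left_mono) auto
      with step[OF c] have *: "rest c v * (w {v, c} + 2) \<le> w {v, c} * w {v, c}"
        by (simp add: power2_eq_square)
      show ?thesis
      proof (rule ccontr)
        \<comment> \<open>With \<open>*\<close> this gives
          \<open>2 * rest c v < w {v, c} < rest c v + 1\<close>, hence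
          \<open>rest c v < 1\<close>.\<close>
        assume "\<not> ?thesis"
        then have lt: "w {v, c} < rest c v + 1" by simp
        have "w {v, c} * w {v, c} < w {v, c} * (rest c v + 1)"
          using lt wle(2)[OF c] by (intro mult_strict_left_mono) auto
        with * have "2 * rest c v < w {v, c}" by (simp add: algebra_simps)
        with lt r show False by simp
      qed
    qed
    \<comment> \<open>Each of the at least two neighbours other than \<open>u\<close> pays 1 of its
      weight for the constant 2; those in \<open>C\<close> still have \<open>rest c v\<close>
      left.\<close>
    have "2 + (\<Sum>c\<in>C. rest c v) \<le> real (card (N v - {u})) + (\<Sum>c\<in>N v - {u}. if c \<in> C then rest c v else 0)"
      using two CN by (simp add: sum.inter_restrict[symmetric] Int_absorb1)
    also have "\<dots> = (\<Sum>c\<in>N v - {u}. 1 + (if c \<in> C then rest c v else 0))"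
      by (simp add: sum.distrib)
    also have "\<dots> \<le> (\<Sum>c\<in>N v - {u}. w {v, c})"
    proof (rule sum_mono)
      fix c assume "c \<in> N v - {u}"
      then show "1 + (if c \<in> C then rest c v else 0) \<le> w {v, c}" using le[of c] N_ge_1[of c v] by auto
    qed
    finally show ?thesis using True by (simp add: rest_eq[OF u])
  qed
qed

end

section \<open>Rooted spanning trees of finite connected sets and the count of branch
  vertices\<close>

text \<open>The value of \<open>par\<close> at the root is arbitrary.\<close>

inductive rooted :: "'a graph \<Rightarrow> 'a \<Rightarrow> 'a set \<Rightarrow> ('a \<Rightarrow> 'a) \<Rightarrow> bool" for H r where
  root: "rooted H r {r} par"
| step: "rooted H r S par \<Longrightarrow> x \<in> S \<Longrightarrow> y \<notin> S \<Longrightarrow> adj H x y \<Longrightarrow> rooted H r (insert y S) (par(y := x))"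

text \<open>Connectedness of the induced subgraph in cut form, which directly supplies the next edge
  when a rooted tree is grown.\<close>

definition conn :: "'a graph \<Rightarrow> 'a set \<Rightarrow> bool" where
  "conn H S \<longleftrightarrow> (\<forall>A. A \<subseteq> S \<and> A \<noteq> {} \<and> A \<noteq> S \<longrightarrow> (\<exists>x\<in>A. \<exists>y\<in>S - A. adj H x y))"

lemma rooted_finite: "rooted H r S par \<Longrightarrow> finite S"
  by (induction rule: rooted.induct) auto

lemma rooted_root: "rooted H r S par \<Longrightarrow> r \<in> S"
  by (induction rule: rooted.induct) auto

lemma rooted_par:
  "rooted H r S par \<Longrightarrow> v \<in> S \<Longrightarrow> v \<noteq> r \<Longrightarrow> par v \<in> S \<and> adj H (par v) v \<and> par v \<noteq> v"
  by (induction rule: rooted.induct) auto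

text \<open>Ensures that the parent of a vertex is never among its children, as
  \<open>rest_recursion\<close> demands.\<close>

lemma rooted_par_par:
  "rooted H r S par \<Longrightarrow> v \<in> S \<Longrightarrow> v \<noteq> r \<Longrightarrow> par v \<noteq> r \<Longrightarrow> par (par v) \<noteq> v"
proof (induction rule: rooted.induct)
  case (step S par x y)
  then show ?case using rooted_par[OF step.hyps(1)] by (auto split: if_splits)
qed simp

text \<open>Grow the tree across the cut between \<open>A\<close> and \<open>S\<close>. Keeping
  \<open>par\<close> on \<open>A\<close> allows the first edge to be prescribed.\<close>

lemma rooted_extend:
  assumes "rooted H r A par" "A \<subseteq> S" "finite S" "conn H S"
  shows "\<exists>par'. rooted H r S par' \<and> (\<forall>v\<in>A. par' v = par v)"
  using assms
proof (induction "card (S - A)" arbitrary: A par rule: less_induct)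
  case less
  show ?case
  proof (cases "A = S")
    case True then show ?thesis using less.prems by auto
  next
    case False
    then obtain x y where xy: "x \<in> A" "y \<in> S - A" "adj H x y"
      using less.prems rooted_root[OF less.prems(1)] unfolding conn_def by blast
    have "rooted H r (insert y A) (par(y := x))" using less.prems xy by (auto intro: rooted.step)
    moreover have "card (S - insert y A) < card (S - A)"
      using xy less.prems by (intro psubset_card_mono) auto
    ultimately obtain par' where "rooted H r S par' \<and> (\<forall>v\<in>insert y A. par' v = (par(y := x)) v)"
      using less.hyps[of "insert y A" "par(y := x)"] xy less.prems by auto
    then show ?thesis using xy by (metis DiffD2 fun_upd_other insertCI)
  qed
qed

context tree_like_weight
begin

text \<open>Induction along the growth of the tree: the hypothesis covers edges at the root,
  \<open>dom_child\<close> all later ones.\<close>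

lemma rooted_dom:
  assumes "rooted F r S par" and "\<And>c. c \<in> S \<Longrightarrow> adj F c r \<Longrightarrow> dominates c r"
    and "v \<in> S" "v \<noteq> r"
  shows "dominates v (par v)"
  using assms
proof (induction arbitrary: v rule: rooted.induct)
  case (step S par x y)
  show ?case
  proof (cases "v = y")
    case False then show ?thesis using step.IH[of v] step.prems by auto
  next
    case True
    have yx: "adj F y x" using step.hyps by (simp add: adj_commute)
    show ?thesis
    proof (cases "x = r")
      case True then show ?thesis using \<open>v = y\<close> yx step.prems(1) by auto
    next
      case False
      have "dominates x (par x)" using step.IH[of x] step.prems False step.hyps by auto
      moreover have p: "par x \<in> S" "adj F (par x) x" using rooted_par[OF step.hyps(1,2) False] by auto
      ultimately have "dominates y x"
        using dom_child[of x "par x" y] yx step.hyps F_N N_sym by blast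
      then show ?thesis using \<open>v = y\<close> by simp
    qed
  qed
qed simp

text \<open>Sum \<open>rest_recursion\<close> over all vertices other than the root. The sum
  telescopes, since each rest occurs once at its vertex and once at the parent; only the children of
  the root survive.\<close>

lemma rooted_count:
  assumes R: "rooted F r S par" and root: "\<And>c. c \<in> S \<Longrightarrow> adj F c r \<Longrightarrow> dominates c r"
    and B: "B \<subseteq> S" "\<And>b. b \<in> B \<Longrightarrow> 3 \<le> card (N b)"
  shows "2 * real (card (B - {r})) \<le> (\<Sum>c | c \<in> S - {r} \<and> par c = r. rest c r)"
proof -
  have fin: "finite S" using rooted_finite[OF R] .
  define C where "C v = {c \<in> S - {r}. par c = v}" for v
  have loc: "(if v \<in> B then 2 else 0) + (\<Sum>c\<in>C v. rest c v) \<le> rest v (par v)" if v: "v \<in> S - {r}" for v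
  proof -
    note p = rooted_par[OF R, of v]
    have "C v \<subseteq> {c. adj F c v} - {par v}"
    proof
      fix c assume c: "c \<in> C v"
      then have "adj F c v" using rooted_par[OF R, of c] by (auto simp: C_def adj_commute)
      moreover have "par v \<noteq> c" using c v rooted_par_par[OF R, of c] by (auto simp: C_def)
      ultimately show "c \<in> {c. adj F c v} - {par v}" by auto
    qed
    moreover have "dominates v (par v)" using rooted_dom[OF R root] v by auto
    moreover have "par v \<in> N v" using p v F_N N_sym by blast
    ultimately have "(if 3 \<le> card (N v) then 2 else 0) + (\<Sum>c\<in>C v. rest c v) \<le> rest v (par v)"
      by (intro rest_recursion)
    then show ?thesis using B(2)[of v] by (auto split: if_splits)
  qed
  have "(\<Sum>v\<in>S - {r}. if v \<in> B then 2 else 0) + (\<Sum>v\<in>S - {r}. \<Sum>c\<in>C v. rest c v) \<le> (\<Sum>v\<in>S - {r}. rest v (par v))"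
    unfolding sum.distrib[symmetric] by (rule sum_mono) (rule loc)
  moreover have "(\<Sum>v\<in>S - {r}. if v \<in> B then 2 else 0) = 2 * real (card (B - {r}))"
  proof -
    have "(S - {r}) \<inter> B = B - {r}" using B by auto
    then show ?thesis using fin by (simp add: sum.inter_restrict[symmetric])
  qed
  \<comment> \<open>Group the vertices other than the root by their parent.\<close>
  moreover have "(\<Sum>v\<in>S - {r}. rest v (par v)) = (\<Sum>v\<in>S. \<Sum>c\<in>C v. rest c v)"
  proof -
    have "(\<Sum>v\<in>S. \<Sum>c\<in>C v. rest c v) = (\<Sum>v\<in>S. \<Sum>c\<in>C v. rest c (par c))"
      by (intro sum.cong) (auto simp: C_def)
    also have "\<dots> = (\<Sum>v\<in>S - {r}. rest v (par v))"
      unfolding C_def by (rule sum.group) (use fin rooted_par[OF R] in auto)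
    finally show ?thesis by simp
  qed
  moreover have "(\<Sum>v\<in>S. \<Sum>c\<in>C v. rest c v) = (\<Sum>c\<in>C r. rest c r) + (\<Sum>v\<in>S - {r}. \<Sum>c\<in>C v. rest c v)"
    using fin rooted_root[OF R] by (simp add: sum.remove)
  ultimately show ?thesis by (simp add: C_def)
qed

text \<open>The gain \<open>1 / 2\<close> is what survives the infimum over all weights: it turns a bound by the
  distortion plus one into a bound by its ceiling.\<close>

lemma peak_vertex_bound:
  assumes C: "C \<subseteq> {c. adj F c r}" and dominates: "\<And>c. c \<in> C \<Longrightarrow> \<not> dominates r c"
    and x: "x \<in> C" "\<And>c. c \<in> C \<Longrightarrow> w {r, c} \<le> w {r, x}"
  shows "(\<Sum>c\<in>C. rest c r) + (if 3 \<le> card (N r) then 1 / 2 else 0) \<le> 2 * w {r, x}"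
proof -
  define W where "W = w {r, x}"
  \<comment> \<open>An upper bound for the ratio of \<open>rest c r\<close> to
    \<open>w {r, c}\<close>, because \<open>w / (d r - w)\<close> increases with \<open>w\<close>
    and \<open>W\<close> is the largest weight on \<open>C\<close>.\<close>
  define \<theta> where "\<theta> = W / (d r - W)"
  have CN: "C \<subseteq> N r" using C F_N N_sym by blast
  have W1: "1 \<le> W" using x(1) CN N_ge_1 by (auto simp: W_def)
  have dW: "2 * W < d r" using dominates[OF x(1)] by (simp add: dominates_def W_def)
  have l: "0 \<le> \<theta>" "\<theta> \<le> 1" using W1 dW by (auto simp: \<theta>_def)
  have ld: "\<theta> * d r = W + \<theta> * W"
  proof -
    have "\<theta> * (d r - W) = W" using W1 dW by (simp add: \<theta>_def)
    then show ?thesis by (simp add: algebra_simps)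
  qed
  have q: "rest c r * (d r - w {r, c}) \<le> w {r, c} * w {r, c}" if "c \<in> C" for c
    using rest_mult_le[of c r] C that by (auto simp: rest_def[of r] insert_commute power2_eq_square)
  have le: "rest c r \<le> \<theta> * w {r, c}" if c: "c \<in> C" for c
  proof -
    have 1: "1 \<le> w {r, c}" "w {r, c} \<le> W" using c CN N_ge_1 x(2) by (auto simp: W_def)
    have "rest c r \<le> w {r, c} * w {r, c} / (d r - w {r, c})"
      using q[OF c] 1 dW by (simp add: pos_le_divide_eq)
    also have "\<dots> \<le> w {r, c} * (W / (d r - W))"
      using 1 dW by (auto intro!: mult_left_mono frac_le simp: times_divide_eq_right[symmetric] simp del: times_divide_eq_right)
    finally show ?thesis by (simp add: \<theta>_def mult.commute)
  qed
  show ?thesis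
  proof (cases "3 \<le> card (N r)")
    case False
    have "(\<Sum>c\<in>C. rest c r) \<le> (\<Sum>c\<in>C. \<theta> * w {r, c})" using le by (rule sum_mono)
    also have "\<dots> \<le> \<theta> * d r"
      using sum_le_d[OF CN] l by (simp add: sum_distrib_left[symmetric] mult_left_mono)
    also have "\<dots> \<le> 2 * W" using ld l W1 mult_right_mono[of \<theta> 1 W] by simp
    finally show ?thesis using False by (simp add: W_def)
  next
    case True
    \<comment> \<open>The gain comes from the lightest edge \<open>rn\<close>: \<open>d r\<close> is
      at least three times its weight, so for \<open>n\<close> in \<open>C\<close> the value
      \<open>rest n r\<close> is at most half of it.\<close>
    obtain n where n: "n \<in> N r" "\<And>c. c \<in> N r \<Longrightarrow> w {r, n} \<le> w {r, c}"
    proof -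
      let ?f = "\<lambda>c. w {r, c}"
      have "Min (?f ` N r) \<in> ?f ` N r" using x(1) CN by (intro Min_in) auto
      then obtain n where n: "Min (?f ` N r) = ?f n" "n \<in> N r" by (rule imageE)
      have "?f n \<le> ?f c" if "c \<in> N r" for c
        unfolding n(1)[symmetric] by (rule Min_le) (use that in auto)
      with n(2) show ?thesis by (rule that)
    qed
    let ?n = "w {r, n}"
    have n1: "1 \<le> ?n" "?n \<le> W" using n N_ge_1 x(1) CN by (auto simp: W_def)
    have "3 * ?n \<le> real (card (N r)) * ?n" using True n1 by (intro mult_right_mono) auto
    also have "\<dots> \<le> d r" unfolding wdegree_def using n(2) by (rule sum_bounded_below)
    finally have n3: "3 * ?n \<le> d r" .
    have nC: "rest n r \<le> ?n / 2" if "n \<in> C"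
    proof -
      have "rest n r * (2 * ?n) \<le> rest n r * (d r - ?n)"
        using n3 rest_nonneg[of r n] n(1) N_sym by (intro mult_left_mono) auto
      also have "\<dots> \<le> ?n * ?n" using q[OF that] .
      finally show ?thesis using n1 by (simp add: mult_le_cancel_right)
    qed
    have "(\<Sum>c\<in>C. rest c r) \<le> (\<Sum>c\<in>C. if c = n then ?n / 2 else \<theta> * w {r, c})"
      using le nC by (intro sum_mono) auto
    also have "\<dots> \<le> (\<Sum>c\<in>N r. if c = n then ?n / 2 else \<theta> * w {r, c})"
      by (rule sum_mono2) (use CN N_ge_1 l n1 in \<open>force intro!: mult_nonneg_nonneg\<close>)+
    also have "\<dots> = ?n / 2 + (\<Sum>c\<in>N r - {n}. \<theta> * w {r, c})"
      using n(1) by (simp add: sum.remove[of "N r" n])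
    also have "\<dots> = ?n / 2 + \<theta> * (d r - ?n)"
      using n(1) by (simp add: wdegree_def sum_distrib_left[symmetric] sum_diff1)
    also have "\<dots> = W + \<theta> * (W - ?n) + ?n / 2" using ld by (simp add: algebra_simps)
    \<comment> \<open>The total is \<open>2 * W - ?n / 2\<close>, and \<open>?n\<close> is at least
      1.\<close>
    also have "\<dots> \<le> W + (W - ?n) + ?n / 2" using l n1 mult_right_mono[of \<theta> 1 "W - ?n"] by simp
    finally show ?thesis using True n1 by (simp add: W_def)
  qed
qed

text \<open>Root at an end \<open>r\<close> of the heaviest tree-like edge \<open>xr\<close> within
  \<open>S\<close>, with \<open>x\<close> dominating. If \<open>r\<close> dominates as well, both
  sides of the edge contribute at most its weight; otherwise \<open>r\<close> dominates none of its
  neighbours in the tree and \<open>peak_vertex_bound\<close> applies.\<close>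

lemma branch_bound:
  assumes S: "finite S" "conn F S" and B: "B \<subseteq> S" "\<And>b. b \<in> B \<Longrightarrow> 3 \<le> card (N b)"
    and M: "1 \<le> M" "\<And>e. e \<in> edges G \<Longrightarrow> w e \<le> M"
  shows "real (card B) \<le> M + 3 / 4"
proof (cases "\<exists>x\<in>S. \<exists>y\<in>S. adj F x y")
  case False
  \<comment> \<open>Without edges inside \<open>S\<close>, a nonempty \<open>B\<close> forces
    \<open>S\<close> to be a single vertex.\<close>
  have "card B \<le> 1"
  proof (cases "B = {}")
    case False
    then obtain b where b: "b \<in> B" by blast
    have "S = {b}"
    proof (rule ccontr)
      assume "S \<noteq> {b}"
      then obtain y where "y \<in> S" "adj F b y" using S(2) b B(1) unfolding conn_def
        by (metis DiffD1 empty_not_insert empty_subsetI insert_subset singletonD subset_iff)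
      then show False using \<open>\<not> (\<exists>x\<in>S. \<exists>y\<in>S. adj F x y)\<close> b B(1) by blast
    qed
    then show ?thesis using B(1) by (metis card_mono finite.emptyI finite.insertI is_singletonI is_singleton_altdef)
  qed simp
  then show ?thesis using M by simp
next
  case True
  define P where "P = {(x, y) \<in> S \<times> S. adj F x y}"
  define f where "f = (\<lambda>(x, y). w {x, y})"
  have "finite P" "P \<noteq> {}" using S True by (auto simp: P_def intro: finite_subset[of _ "S \<times> S"])
  then have "Max (f ` P) \<in> f ` P" by (intro Max_in) auto
  then obtain a b where "(a, b) \<in> P" and "f (a, b) = Max (f ` P)" by (metis imageE surj_pair)
  then have max_ab: "w {x, y} \<le> w {a, b}" if "(x, y) \<in> P" for x y
  proof -
    have "f (x, y) \<le> f (a, b)"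
      using \<open>f (a, b) = Max (f ` P)\<close> \<open>finite P\<close> that by simp
    then show ?thesis by (simp add: f_def)
  qed
  from \<open>(a, b) \<in> P\<close> have ab: "a \<in> S" "b \<in> S" "adj F a b" by (auto simp: P_def)
  obtain x r where xr: "x \<in> S" "r \<in> S" "adj F x r" "dominates x r"
    and max: "\<And>u v. u \<in> S \<Longrightarrow> v \<in> S \<Longrightarrow> adj F u v \<Longrightarrow> w {u, v} \<le> w {r, x}"
  proof (cases "dominates a b")
    case True
    then show ?thesis using that[of a b] ab max_ab by (auto simp: P_def insert_commute)
  next
    case False
    then have "dominates b a" using dom_total[OF ab(3)] by simp
    then show ?thesis using that[of b a] ab max_ab by (auto simp: P_def insert_commute adj_commute)
  qed
  let ?W = "w {r, x}"
  have xN: "x \<in> N r" using F_N[OF xr(3)] N_sym by blast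
  have WM: "?W \<le> M" using xN M(2) by (auto simp: nbhd_def adj_def)
  have irr: "x \<noteq> r" using xN simple_graph_adjD(3)[OF simple] by (auto simp: nbhd_def)
  \<comment> \<open>Start with the heaviest edge, so that \<open>x\<close> becomes a child of the
    root.\<close>
  have "rooted F r {x, r} ((\<lambda>_. r)(x := r))"
    using rooted.step[OF rooted.root[of F r "\<lambda>_. r"], of r x] irr xr by (auto simp: adj_commute)
  then obtain par where R: "rooted F r S par" and px: "par x = r"
    using rooted_extend[of F r "{x, r}" _ S] xr S by fastforce
  define C where "C = {c. c \<in> S - {r} \<and> par c = r}"
  have CF: "C \<subseteq> {c. adj F c r}" using rooted_par[OF R] by (auto simp: C_def adj_commute)
  have xC: "x \<in> C" using xr irr px by (simp add: C_def)
  have finC: "finite C" using S by (simp add: C_def)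
  define k where "k = real (card (B - {r}))"
  have cardB: "real (card B) = k + (if r \<in> B then 1 else 0)"
    unfolding k_def
    using card_Suc_Diff1[OF finite_subset[OF B(1) S(1)], of r] by (cases "r \<in> B") auto
  show ?thesis
  proof (cases "dominates r x")
    case True
    have root: "dominates c r" if "c \<in> S" "adj F c r" for c
      using dom_child[OF True xN that(2)] xr(4) by blast
    have "2 * k \<le> rest x r + (\<Sum>c\<in>C - {x}. rest c r)"
      using rooted_count[OF R root B, folded C_def] xC finC by (simp add: sum.remove k_def)
    moreover have "(if 3 \<le> card (N r) then 2 else 0) + (\<Sum>c\<in>C - {x}. rest c r) \<le> rest r x"
      by (rule rest_recursion[OF True xN]) (use CF in auto)
    moreover have "rest x r \<le> ?W" "rest r x \<le> ?W"
      using True xr(4) by (auto simp: dom_iff_rest insert_commute)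
    ultimately have "real (card B) \<le> ?W" using cardB B(2)[of r] by (auto split: if_splits)
    then show ?thesis using WM by simp
  next
    case False
    \<comment> \<open>The heaviest edge at \<open>r\<close> fails to dominate, hence so do the
      lighter ones.\<close>
    have nd: "\<not> dominates r c" if "c \<in> S" "adj F c r" for c
    proof
      assume "dominates r c"
      then have "w {r, x} < w {r, c}" using False by (simp add: dominates_def)
      then show False using max[OF that(1) xr(2) that(2)] by (simp add: insert_commute)
    qed
    have root: "dominates c r" if "c \<in> S" "adj F c r" for c
      using dom_total[OF that(2)] nd[OF that] by simp
    have "2 * k \<le> (\<Sum>c\<in>C. rest c r)"
      using rooted_count[OF R root B, folded C_def] by (simp add: k_def)
    moreover have "(\<Sum>c\<in>C. rest c r) + (if 3 \<le> card (N r) then 1 / 2 else 0) \<le> 2 * ?W"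
    proof (rule peak_vertex_bound[OF CF _ xC])
      fix c assume "c \<in> C"
      then have c: "c \<in> S" "adj F c r" using CF by (auto simp: C_def)
      show "\<not> dominates r c" using nd[OF c] .
      show "w {r, c} \<le> ?W" using max[OF c(1) xr(2) c(2)] by (simp add: insert_commute)
    qed
    \<comment> \<open>If \<open>r\<close> lies in \<open>B\<close>, then
      \<open>2 * k + 1 / 2 \<le> 2 * ?W\<close> and the cardinality is \<open>k + 1\<close>; this is
      the source of 3/4.\<close>
    ultimately have "real (card B) \<le> ?W + 3 / 4" using cardB B(2)[of r] by (auto split: if_splits)
    then show ?thesis using WM by simp
  qed
qed

end

section \<open>Connectivity, cycles and rays\<close>

lemma walk_rtranclp:
  assumes "walk H x p y" shows "(adj H)\<^sup>*\<^sup>* x y"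
proof -
  have "(adj H)\<^sup>*\<^sup>* (hd p) (last p)" if "p \<noteq> []" "successively (adj H) p" for p
    using that
  proof (induction p rule: induct_list012)
    case (3 a b p)
    then show ?case by (auto intro: converse_rtranclp_into_rtranclp)
  qed auto
  then show ?thesis using assms by (auto simp: walk_def)
qed

text \<open>Replaces walks by the closure of adjacency. The latter is reflexive also outside
  \<open>verts H\<close>, hence the membership condition.\<close>

lemma reachable_iff:
  assumes "simple_graph H"
  shows "reachable H x y \<longleftrightarrow> x \<in> verts H \<and> (adj H)\<^sup>*\<^sup>* x y"
proof
  assume "reachable H x y"
  then obtain p where p: "walk H x p y" by (auto simp: reachable_def)
  then have "x \<in> verts H" by (auto simp: walk_def)
  with walk_rtranclp[OF p] show "x \<in> verts H \<and> (adj H)\<^sup>*\<^sup>* x y" by simp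
next
  assume "x \<in> verts H \<and> (adj H)\<^sup>*\<^sup>* x y"
  then have "(adj H)\<^sup>*\<^sup>* x y" "x \<in> verts H" by auto
  then show "reachable H x y"
  proof (induction rule: rtranclp_induct)
    case base
    then have "walk H x [x] x" by (simp add: walk_def)
    then show ?case by (auto simp: reachable_def)
  next
    case (step y z)
    then obtain p where "walk H x p y" by (auto simp: reachable_def)
    then have "walk H x (p @ [z]) z"
      using step simple_graph_adjD[OF assms step.hyps(2)] by (auto simp: walk_def successively_append_iff)
    then show ?case by (auto simp: reachable_def)
  qed
qed

lemma adj_rtranclp_sym: "(adj H)\<^sup>*\<^sup>* x y \<Longrightarrow> (adj H)\<^sup>*\<^sup>* y x"
  by (rule sympD[OF symp_rtranclp]) (auto simp: symp_def adj_commute)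

lemma adj_rtranclp_verts:
  assumes "simple_graph H" "(adj H)\<^sup>*\<^sup>* x y" "x \<in> verts H" shows "y \<in> verts H"
  using assms(2,3) by (induction rule: rtranclp_induct) (use simple_graph_adjD[OF assms(1)] in auto)

lemma adj_rtranclp_closed:
  assumes "(adj H)\<^sup>*\<^sup>* x y" "x \<in> A" "\<And>u v. u \<in> A \<Longrightarrow> adj H u v \<Longrightarrow> v \<in> A"
  shows "y \<in> A"
  using assms by (induction rule: rtranclp_induct) auto

lemma connected_graph_iff:
  assumes "simple_graph H"
  shows "connected_graph H \<longleftrightarrow> verts H \<noteq> {} \<and> (\<forall>x\<in>verts H. \<forall>y\<in>verts H. (adj H)\<^sup>*\<^sup>* x y)"
  using reachable_iff[OF assms] by (auto simp: connected_graph_def)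

lemma connected_graphI:
  assumes "simple_graph H" "k \<in> verts H" "\<And>x. x \<in> verts H \<Longrightarrow> (adj H)\<^sup>*\<^sup>* k x"
  shows "connected_graph H"
  unfolding connected_graph_iff[OF assms(1)]
  using assms by (metis adj_rtranclp_sym empty_iff rtranclp_trans)

lemma connected_graph_closed:
  assumes "simple_graph H" "connected_graph H" "a \<in> A" "a \<in> verts H"
    "\<And>u v. u \<in> A \<Longrightarrow> adj H u v \<Longrightarrow> v \<in> A"
  shows "verts H \<subseteq> A"
  using assms connected_graph_iff[OF assms(1)] adj_rtranclp_closed[of H a _ A] by blast

lemma simple_component_of:
  assumes "simple_graph H" shows "simple_graph (component_of H x)"
  using assms by (auto simp: simple_graph_def component_of_def)

lemma adj_component_of:
  assumes "simple_graph H" "u \<in> verts (component_of H x)"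
  shows "adj (component_of H x) u v \<longleftrightarrow> adj H u v"
proof -
  have u: "reachable H x u" using assms(2) by (simp add: component_of_def)
  then have "reachable H x v" if "adj H u v"
    using that by (auto simp: reachable_iff[OF assms(1)])
  then show ?thesis using u by (auto simp: component_of_def adj_def)
qed

lemma component_of_rtranclp:
  assumes "simple_graph H" "x \<in> verts H" "y \<in> verts (component_of H x)"
  shows "(adj (component_of H x))\<^sup>*\<^sup>* x y"
proof -
  let ?C = "component_of H x"
  have x: "x \<in> verts ?C" using assms(2) by (simp add: component_of_def reachable_iff[OF assms(1)])
  have "(adj H)\<^sup>*\<^sup>* x y" using assms(3) by (simp add: component_of_def reachable_iff[OF assms(1)])
  then show ?thesis
  proof (induction rule: rtranclp_induct)
    case (step y z)
    have "y \<in> verts ?C"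
      using adj_rtranclp_verts[OF simple_component_of[OF assms(1)] step.IH x] .
    then have "adj ?C y z" using adj_component_of[OF assms(1)] step.hyps by blast
    with step.IH show ?case by auto
  qed simp
qed

lemma connected_component_of:
  assumes "simple_graph H" "x \<in> verts H"
  shows "connected_graph (component_of H x)"
proof (rule connected_graphI[OF simple_component_of[OF assms(1)]])
  show "x \<in> verts (component_of H x)"
    using assms(2) by (simp add: component_of_def reachable_iff[OF assms(1)])
qed (rule component_of_rtranclp[OF assms])

section \<open>Finite connected sets containing given vertices\<close>

lemma conn_insert:
  assumes S: "conn H S" and y: "y \<in> S" and yz: "adj H y z"
  shows "conn H (insert z S)"
  unfolding conn_def
proof (intro allI impI)
  fix A assume A: "A \<subseteq> insert z S \<and> A \<noteq> {} \<and> A \<noteq> insert z S"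
  show "\<exists>x\<in>A. \<exists>v\<in>insert z S - A. adj H x v"
  proof (cases "A \<inter> S = {} \<or> A \<inter> S = S")
    case True
    then show ?thesis
    proof
      assume "A \<inter> S = {}"
      then have "A = {z}" "y \<notin> A" using A y by auto
      then show ?thesis using y yz by (auto simp: adj_commute)
    next
      assume "A \<inter> S = S"
      then have "z \<notin> A" "y \<in> A" using A y by auto
      then show ?thesis using yz by auto
    qed
  next
    case False
    then show ?thesis using S[unfolded conn_def, rule_format, of "A \<inter> S"] by auto
  qed
qed

text \<open>Add the points of \<open>B\<close> one at a time, together with a path from
  \<open>x\<close>, which always lies in the set already built.\<close>

lemma finite_conn_superset:
  assumes "finite B" "\<And>b. b \<in> B \<Longrightarrow> (adj H)\<^sup>*\<^sup>* x b"
  shows "\<exists>S. finite S \<and> conn H S \<and> x \<in> S \<and> B \<subseteq> S"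
  using assms
proof (induction B)
  case empty
  have "conn H {x}" by (auto simp: conn_def)
  then show ?case by blast
next
  case (insert b B)
  then obtain S where S: "finite S" "conn H S" "x \<in> S" "B \<subseteq> S" by auto
  have "(adj H)\<^sup>*\<^sup>* x b" using insert.prems by simp
  then have "\<exists>S'. finite S' \<and> conn H S' \<and> S \<subseteq> S' \<and> b \<in> S'"
  proof (induction rule: rtranclp_induct)
    case base then show ?case using S by blast
  next
    case (step y z)
    then obtain S' where "finite S'" "conn H S'" "S \<subseteq> S'" "y \<in> S'" by blast
    then show ?case using conn_insert[of H S' y z] step.hyps(2)
      by (intro exI[of _ "insert z S'"]) auto
  qed
  then show ?case using S by blast
qed

lemma Suc_mod_bij: "0 < n \<Longrightarrow> bij_betw (\<lambda>i. Suc i mod n) {..<n} {..<n}"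
proof -
  assume n: "0 < n"
  have "inj_on (\<lambda>i. Suc i mod n) {..<n}"
    by (auto simp: inj_on_def mod_Suc split: if_splits)
  moreover have "(\<lambda>i. Suc i mod n) ` {..<n} \<subseteq> {..<n}" using n by auto
  ultimately show ?thesis by (simp add: bij_betw_def endo_inj_surj)
qed

section \<open>Cycles, rays and double rays of tree-like edges\<close>

context tree_like_weight
begin

lemma F_simple: "simple_graph F"
  using simple by (auto simp: simple_graph_def tree_like_subgraph_def tree_like_def)

text \<open>A third neighbour would add at least 1 to \<open>d v\<close>.\<close>

lemma N_eq_pair:
  assumes "a \<in> N v" "b \<in> N v" "a \<noteq> b" "d v \<le> w {v, a} + w {v, b}"
  shows "N v = {a, b}"
proof -
  have False if c: "c \<in> N v" "c \<noteq> a" "c \<noteq> b" for c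
  proof -
    have "w {v, a} + w {v, b} + w {v, c} = (\<Sum>u\<in>{a, b, c}. w {v, u})"
      using assms c by (simp add: eq_commute)
    also have "\<dots> \<le> d v" using assms c by (intro sum_le_d) auto
    finally show False using assms(4) N_ge_1[OF c(1)] by simp
  qed
  then show ?thesis using assms by auto
qed

lemma d_pos: "u \<in> N v \<Longrightarrow> 0 < d v"
  using sum_le_d[of "{u}" v] N_ge_1[of u v] by simp

text \<open>The edge inequalities sum to at least the length \<open>n\<close> of the cycle.
  Regrouped by vertices, the same sum has \<open>n\<close> terms of at most 1, so each vertex has
  its whole weight on its two cycle edges.\<close>

lemma tree_like_cycle_N:
  assumes c: "is_cycle F c" and i: "i < length c"
  shows "N (c ! (Suc i mod length c)) = {c ! i, c ! (Suc (Suc i mod length c) mod length c)}"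
proof -
  define n where "n = length c"
  define \<sigma> where "\<sigma> = (\<lambda>i. Suc i mod n)"
  define W where "W = (\<lambda>i. w {c ! i, c ! \<sigma> i})"
  have n3: "3 \<le> n" and dist: "distinct c" and a: "\<And>i. i < n \<Longrightarrow> adj F (c ! i) (c ! \<sigma> i)"
    using c by (auto simp: is_cycle_def n_def \<sigma>_def)
  have \<sigma>: "bij_betw \<sigma> {..<n} {..<n}" unfolding \<sigma>_def using n3 by (intro Suc_mod_bij) auto
  have \<sigma>n: "\<sigma> i < n" for i using n3 by (simp add: \<sigma>_def)
  have ne: "c ! i \<noteq> c ! \<sigma> (\<sigma> i)" if "i < n" for i
  proof -
    have "i \<noteq> \<sigma> (\<sigma> i)" using that n3 by (auto simp: \<sigma>_def mod_Suc split: if_splits)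
    then show ?thesis using dist that \<sigma>n[of "\<sigma> i"] by (simp add: nth_eq_iff_index_eq n_def)
  qed
  have N1: "c ! \<sigma> i \<in> N (c ! i)" "c ! i \<in> N (c ! \<sigma> i)" if "i < n" for i
    using F_N[OF a[OF that]] N_sym by auto
  have edge: "1 \<le> W i / d (c ! i) + W i / d (c ! \<sigma> i)" if "i < n" for i
  proof -
    have "(d (c ! i) - W i) * (d (c ! \<sigma> i) - W i) \<le> W i * W i"
      using a[OF that] tree_like_ineq by (simp add: tree_like_subgraph_adj W_def power2_eq_square)
    then have "d (c ! i) * d (c ! \<sigma> i) \<le> W i * d (c ! \<sigma> i) + W i * d (c ! i)"
      by (simp add: algebra_simps)
    then show ?thesis using d_pos[OF N1(1)[OF that]] d_pos[OF N1(2)[OF that]]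
      by (simp add: divide_simps mult.commute)
  qed
  \<comment> \<open>The share of the weight at \<open>c ! \<sigma> i\<close> that lies off its two
    cycle edges.\<close>
  define t where "t = (\<lambda>i. 1 - (W i / d (c ! \<sigma> i) + W (\<sigma> i) / d (c ! \<sigma> i)))"
  have t0: "0 \<le> t i" if "i < n" for i
  proof -
    have "W i + W (\<sigma> i) = (\<Sum>u\<in>{c ! i, c ! \<sigma> (\<sigma> i)}. w {c ! \<sigma> i, u})"
      using ne[OF that] by (simp add: W_def insert_commute)
    also have "\<dots> \<le> d (c ! \<sigma> i)" using N1[OF that] N1[OF \<sigma>n[of i]] by (intro sum_le_d) auto
    finally show ?thesis using d_pos[OF N1(2)[OF that]] by (simp add: t_def divide_simps)
  qed
  have "(\<Sum>i<n. t i) \<le> 0"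
  proof -
    have "(\<Sum>i<n. W (\<sigma> i) / d (c ! \<sigma> i)) = (\<Sum>i<n. W i / d (c ! i))"
      using sum.reindex_bij_betw[OF \<sigma>, of "\<lambda>i. W i / d (c ! i)"] .
    then have "(\<Sum>i<n. t i) = real n - (\<Sum>i<n. W i / d (c ! i) + W i / d (c ! \<sigma> i))"
      by (simp add: t_def sum_subtractf sum.distrib)
    moreover have "(\<Sum>i<n. 1) \<le> (\<Sum>i<n. W i / d (c ! i) + W i / d (c ! \<sigma> i))"
      using edge by (intro sum_mono) auto
    ultimately show ?thesis by simp
  qed
  moreover have "0 \<le> (\<Sum>i<n. t i)" using t0 by (intro sum_nonneg) auto
  ultimately have "\<forall>i\<in>{..<n}. t i = 0"
    using sum_nonneg_eq_0_iff[of "{..<n}" t] t0 by auto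
  then have "t i = 0" using i by (simp add: n_def)
  then have "d (c ! \<sigma> i) \<le> W i + W (\<sigma> i)"
    using d_pos[OF N1(2), of i] i by (simp add: t_def n_def divide_simps split: if_splits)
  then show ?thesis
    using N_eq_pair[of "c ! i" "c ! \<sigma> i" "c ! \<sigma> (\<sigma> i)"] N1[of i] N1[of "\<sigma> i"] ne[of i] \<sigma>n[of i] i
    by (simp add: W_def \<sigma>_def n_def insert_commute)
qed

text \<open>No edge leaves the cycle, so by connectedness the cycle is all of \<open>G\<close>;
  lengths 3 to 5 contradict tree-likeness of its edges.\<close>

lemma tree_like_cycle_iso:
  assumes conn: "connected_graph G" and c: "is_cycle F c"
  shows "6 \<le> length c \<and> graph_iso G (cycle_graph (length c))"
proof
  define n where "n = length c"
  have n3: "3 \<le> n" and dist: "distinct c" and a: "\<And>i. i < n \<Longrightarrow> adj F (c ! i) (c ! (Suc i mod n))"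
    using c by (auto simp: is_cycle_def n_def)
  have cG: "is_cycle G c" using c by (auto simp: is_cycle_def tree_like_subgraph_adj tree_like_adj)
  have "tree_like G {c ! 0, c ! (Suc 0 mod n)}" using a[of 0] n3 by (simp add: tree_like_subgraph_adj)
  moreover have "{c ! 0, c ! (Suc 0 mod n)} \<in> cycle_edges c"
    using n3 by (auto simp: cycle_edges_def n_def intro!: exI[of _ 0])
  ultimately have "length c \<notin> {3, 4, 5}" using cG by (auto simp: tree_like_def)
  then show "6 \<le> length c" using n3 by (auto simp: n_def)
  have bij: "bij_betw (\<lambda>i. c ! i) {..<n} (set c)"
    using dist by (simp add: bij_betw_nth n_def)
  have nb: "\<exists>j<n. {u, v} = {c ! j, c ! (Suc j mod n)}" if u: "u \<in> set c" and "adj G u v" for u v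
  proof -
    obtain k where k: "k < n" "u = c ! k" using u by (auto simp: in_set_conv_nth n_def)
    then have "k \<in> (\<lambda>i. Suc i mod n) ` {..<n}"
      using Suc_mod_bij[of n] n3 by (simp add: bij_betw_def)
    then obtain j where j: "j < n" "k = Suc j mod n" by auto
    have "v \<in> N u" using that by (simp add: nbhd_def)
    then have "v = c ! j \<or> v = c ! (Suc k mod n)"
      using tree_like_cycle_N[OF c, of j] j k by (simp add: n_def)
    then show ?thesis using j k by (metis insert_commute)
  qed
  have verts: "verts G = set c"
  proof
    have "c ! 0 \<in> set c" using n3 by (intro nth_mem) (auto simp: n_def)
    moreover have "c ! 0 \<in> verts G"
      using simple_graph_adjD(1)[OF simple] cG n3 by (force simp: is_cycle_def n_def)
    moreover have "v \<in> set c" if "u \<in> set c" "adj G u v" for u v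
    proof -
      obtain j where "j < n" "{u, v} = {c ! j, c ! (Suc j mod n)}" using nb \<open>u \<in> set c\<close> \<open>adj G u v\<close> by blast
      then have "v \<in> {c ! j, c ! (Suc j mod n)}" by blast
      then show ?thesis using \<open>j < n\<close> n3 by (auto simp: n_def intro!: nth_mem mod_less_divisor)
    qed
    ultimately show "verts G \<subseteq> set c" by (rule connected_graph_closed[OF simple conn])
    show "set c \<subseteq> verts G"
      using simple_graph_adjD(1)[OF simple] cG by (force simp: is_cycle_def in_set_conv_nth)
  qed
  have edges: "edges G = (\<lambda>j. {c ! j, c ! (Suc j mod n)}) ` {..<n}"
  proof
    show "edges G \<subseteq> (\<lambda>j. {c ! j, c ! (Suc j mod n)}) ` {..<n}"
    proof
      fix e assume e: "e \<in> edges G"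
      then obtain u v where uv: "e = {u, v}" "adj G u v" using simple_graph_edgeE[OF simple] by metis
      then have "u \<in> set c" using verts simple_graph_adjD(1)[OF simple] by blast
      then obtain j where "j < n" "{u, v} = {c ! j, c ! (Suc j mod n)}" using nb uv(2) by blast
      then show "e \<in> (\<lambda>j. {c ! j, c ! (Suc j mod n)}) ` {..<n}" using uv(1) by blast
    qed
    show "(\<lambda>j. {c ! j, c ! (Suc j mod n)}) ` {..<n} \<subseteq> edges G"
      using cG by (auto simp: is_cycle_def adj_def n_def)
  qed
  define f where "f = the_inv_into {..<n} (\<lambda>i. c ! i)"
  have f: "bij_betw f (set c) {..<n}" unfolding f_def by (rule bij_betw_the_inv_into[OF bij])
  have fc: "f (c ! j) = j" if "j < n" for j
    unfolding f_def using bij that by (simp add: bij_betw_def the_inv_into_f_f)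
  have "edges (cycle_graph n) = (\<lambda>e. f ` e) ` edges G"
  proof -
    have "f ` {c ! j, c ! (Suc j mod n)} = {j, Suc j mod n}" if "j < n" for j
      using fc that n3 by simp
    then have "(\<lambda>e. f ` e) ` edges G = (\<lambda>j. {j, Suc j mod n}) ` {..<n}"
      unfolding edges image_image by (intro image_cong) auto
    then show ?thesis by (auto simp: cycle_graph_def)
  qed
  then show "graph_iso G (cycle_graph (length c))"
    unfolding graph_iso_def using f verts by (auto simp: cycle_graph_def n_def)
qed

text \<open>Otherwise the weights along the ray would decay geometrically.\<close>

lemma ray_dom:
  assumes inj: "inj r" and adj: "\<And>i. adj F (r i) (r (Suc i))"
  shows "dominates (r 0) (r 1)"
proof (rule ccontr)
  define W where "W i = w {r i, r (Suc i)}" for i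
  define A where "A i = rest (r i) (r (Suc i))" for i
  define \<rho> where "\<rho> = W 0 / A 0"
  have N1: "r (Suc i) \<in> N (r i)" "r i \<in> N (r (Suc i))" for i using F_N[OF adj[of i]] N_sym by auto
  have W1: "1 \<le> W i" for i using N_ge_1[OF N1(1)] by (simp add: W_def)
  assume "\<not> dominates (r 0) (r 1)"
  then have "W 0 < A 0" by (simp add: dom_iff_rest W_def A_def)
  then have \<rho>: "0 < \<rho>" "\<rho> < 1" using W1[of 0] by (auto simp: \<rho>_def)
  \<comment> \<open>The second conjunct drives the decay:
    \<open>A i * ?b \<le> W i * W i \<le> \<rho> * A i * W i\<close> gives
    \<open>W (Suc i) \<le> ?b \<le> \<rho> * W i\<close>, and \<open>W i \<le> A (Suc i)\<close>
    restores it.\<close>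
  have "W i \<le> \<rho> ^ i * W 0 \<and> W i \<le> \<rho> * A i" for i
  proof (induction i)
    case 0
    then show ?case using \<open>W 0 < A 0\<close> W1[of 0] by (simp add: \<rho>_def)
  next
    case (Suc i)
    let ?b = "rest (r (Suc i)) (r i)"
    have ne: "r (Suc (Suc i)) \<noteq> r i" using inj by (simp add: inj_eq)
    have A: "0 < A i" using Suc \<rho> W1[of i] by (smt (verit) mult_nonneg_nonpos)
    have "A i * ?b \<le> W i * W i"
      using rest_mult_le[OF adj[of i]] by (simp add: A_def W_def power2_eq_square)
    also have "\<dots> \<le> (\<rho> * A i) * W i" using Suc W1[of i] by (intro mult_right_mono) auto
    finally have "?b \<le> \<rho> * W i" using A by (simp add: mult.assoc mult.left_commute[of \<rho>])
    moreover have "W (Suc i) \<le> ?b"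
      unfolding W_def using rest_ge[OF N1(2) N1(1)] ne by simp
    ultimately have 1: "W (Suc i) \<le> \<rho> * W i" by simp
    have "W i \<le> A (Suc i)"
      unfolding W_def A_def using rest_ge[OF N1(1) N1(2), of "Suc i"] ne
      by (metis N1 insert_commute rest_ge)
    then have "\<rho> * W i \<le> \<rho> * A (Suc i)" using \<rho> by simp
    moreover have "\<rho> * W i \<le> \<rho> * (\<rho> ^ i * W 0)" using Suc \<rho> by (intro mult_left_mono) auto
    ultimately show ?case using 1 by (simp add: mult.assoc)
  qed
  moreover obtain i where "\<rho> ^ i < 1 / W 0"
    using real_arch_pow_inv[of "1 / W 0" \<rho>] \<rho> W1[of 0] by auto
  then have "\<rho> ^ i * W 0 < 1" using W1[of 0] by (simp add: field_simps)
  ultimately show False using W1[of i] by (meson less_le_not_le order_trans)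
qed

text \<open>Apply \<open>ray_dom\<close> to both rays starting at \<open>f i\<close>; the two
  dominations add up to the hypothesis of \<open>N_eq_pair\<close>.\<close>

lemma double_ray_N:
  fixes f :: "int \<Rightarrow> 'a"
  assumes inj: "inj f" and adj: "\<And>i. adj F (f i) (f (i + 1))"
  shows "N (f i) = {f (i - 1), f (i + 1)}"
proof -
  have adj': "adj F (f i) (f (i - 1))" for i using adj[of "i - 1"] by (simp add: adj_commute)
  have "dominates (f i) (f (i + 1))"
    using ray_dom[of "\<lambda>n. f (i + int n)"] inj adj[of "i + int _"]
    by (force simp: inj_def add.assoc add.commute[of 1])
  moreover have "dominates (f i) (f (i - 1))"
    using ray_dom[of "\<lambda>n. f (i - int n)"] inj adj'[of "i - int _"]
    by (force simp: inj_def diff_diff_eq add.commute[of 1])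
  ultimately have "d (f i) \<le> w {f i, f (i - 1)} + w {f i, f (i + 1)}" by (simp add: dominates_def)
  moreover have "f (i - 1) \<noteq> f (i + 1)" using inj by (simp add: inj_eq)
  ultimately show ?thesis using N_eq_pair F_N[OF adj] F_N[OF adj'] by blast
qed

end

section \<open>Infinite locally finite trees and their ends\<close>

text \<open>Koenig's lemma along geodesics from \<open>k\<close>: the distance
  \<open>\<delta>\<close> grows by one in each step, which makes the ray injective.\<close>

lemma infinite_graph_has_ray:
  assumes T: "simple_graph T" "connected_graph T" and fin: "\<And>x. finite (nbhd T x)"
    and inf: "infinite (verts T)" and k: "k \<in> verts T"
  shows "\<exists>r. ray T r \<and> r 0 = k"
proof -
  let ?R = "\<lambda>n. (adj T) ^^ n"
  define \<delta> where "\<delta> x = (LEAST n. ?R n k x)" for x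
  have conn: "\<exists>n. ?R n k x" if "x \<in> verts T" for x
    using T that k by (simp add: connected_graph_iff rtranclp_power[symmetric])
  have R\<delta>: "?R (\<delta> x) k x" if "x \<in> verts T" for x
    unfolding \<delta>_def using conn[OF that] by (rule LeastI_ex)
  have \<delta>_le: "\<delta> y \<le> \<delta> x + m" if "x \<in> verts T" "?R m x y" for x y m
  proof -
    have "?R (\<delta> x + m) k y" using R\<delta>[OF that(1)] that(2) by (auto simp: relpowp_add)
    then show ?thesis unfolding \<delta>_def[of y] by (rule Least_le)
  qed
  \<comment> \<open>The vertices that some geodesic from \<open>k\<close> reaches through
    \<open>x\<close>.\<close>
  define D where "D x = {y \<in> verts T. \<exists>m. ?R m x y \<and> \<delta> y = \<delta> x + m}" for x
  have "\<delta> k = 0" unfolding \<delta>_def by (rule Least_eq_0) simp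
  then have "D k = verts T" using R\<delta> by (auto simp: D_def)
  then have start: "k \<in> verts T \<and> infinite (D k)" using k inf by simp
  have nxt: "\<exists>y. (y \<in> verts T \<and> infinite (D y)) \<and> adj T x y \<and> \<delta> y = Suc (\<delta> x)"
    if x: "x \<in> verts T \<and> infinite (D x)" for x
  proof -
    let ?C = "{y \<in> nbhd T x. \<delta> y = Suc (\<delta> x)}"
    \<comment> \<open>Finitely many sets \<open>D y\<close> cover \<open>D x\<close> up to the point
      \<open>x\<close>, so one of them is infinite.\<close>
    have "D x \<subseteq> insert x (\<Union>y\<in>?C. D y)"
    proof
      fix z assume "z \<in> D x"
      then obtain m where z: "z \<in> verts T" "?R m x z" "\<delta> z = \<delta> x + m" by (auto simp: D_def)
      show "z \<in> insert x (\<Union>y\<in>?C. D y)"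
      proof (cases m)
        case 0 then show ?thesis using z by simp
      next
        case (Suc l)
        then obtain y where y: "adj T x y" "?R l y z" using relpowp_Suc_D2[of l "adj T" x z] z(2) by blast
        have yT: "y \<in> verts T" using simple_graph_adjD[OF T(1) y(1)] by simp
        have "\<delta> z \<le> \<delta> y + l" using \<delta>_le[OF yT y(2)] .
        moreover have "\<delta> y \<le> \<delta> x + 1" using \<delta>_le[of x 1 y] x y(1) by auto
        ultimately have "\<delta> y = Suc (\<delta> x)" using z(3) Suc by simp
        moreover then have "z \<in> D y" using z y Suc by (auto simp: D_def)
        ultimately show ?thesis using y(1) by (auto simp: nbhd_def)
      qed
    qed
    then have "infinite (insert x (\<Union>y\<in>?C. D y))" using x infinite_super by blast
    then obtain y where "y \<in> ?C" "infinite (D y)" using fin[of x] by auto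
    moreover then have "y \<in> verts T" using simple_graph_adjD(2)[OF T(1)] by (auto simp: nbhd_def)
    ultimately show ?thesis by (intro exI[of _ y]) (simp add: nbhd_def)
  qed
  have "\<exists>r. \<forall>n. ((r n \<in> verts T \<and> infinite (D (r n))) \<and> (n = 0 \<longrightarrow> r n = k)) \<and>
      (adj T (r n) (r (Suc n)) \<and> \<delta> (r (Suc n)) = Suc (\<delta> (r n)))"
  proof (rule dependent_nat_choice)
    show "\<exists>x. (x \<in> verts T \<and> infinite (D x)) \<and> (0 = 0 \<longrightarrow> x = k)" using start by blast
    fix x and n :: nat
    assume "(x \<in> verts T \<and> infinite (D x)) \<and> (n = 0 \<longrightarrow> x = k)"
    then show "\<exists>y. ((y \<in> verts T \<and> infinite (D y)) \<and> (Suc n = 0 \<longrightarrow> y = k)) \<and>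
        adj T x y \<and> \<delta> y = Suc (\<delta> x)"
      using nxt[of x] by auto
  qed
  then obtain r where r: "r 0 = k" and step: "\<And>n. adj T (r n) (r (Suc n)) \<and> \<delta> (r (Suc n)) = Suc (\<delta> (r n))"
    by blast
  have "\<delta> (r n) = n" for n
    by (induction n) (use r step \<open>\<delta> k = 0\<close> in auto)
  then have "inj r" by (metis injI)
  moreover have "range r \<subseteq> verts T" using step simple_graph_adjD[OF T(1)] by auto
  ultimately show ?thesis using r step by (auto simp: ray_def)
qed

lemma degree_two_nbhd:
  assumes "finite (nbhd T v)" "v \<in> verts T" "v \<notin> branch_verts T" "a \<in> nbhd T v" "b \<in> nbhd T v" "a \<noteq> b"
  shows "nbhd T v = {a, b}"
proof -
  have "card (nbhd T v) \<le> card {a, b}"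
    using assms by (auto simp: branch_verts_def vertex_degree_def)
  then show ?thesis using card_seteq[of "nbhd T v" "{a, b}"] assms by auto
qed

text \<open>An injective ray leaves every finite set, so each ray finally runs inside any given tail
  of \<open>t\<close>.\<close>

lemma one_endedI:
  assumes T: "simple_graph T" and t: "ray T t" and fin: "finite (verts T - range t)"
  shows "one_ended T"
proof -
  have inj: "inj t" and tT: "range t \<subseteq> verts T" and adj: "\<And>i. adj T (t i) (t (Suc i))"
    using t by (auto simp: ray_def)
  have same: "same_end T r s" if rs: "ray T r" "ray T s" for r s
    unfolding same_end_def
  proof (intro allI impI)
    fix S assume S: "finite S \<and> S \<subseteq> verts T"
    let ?H = "remove_verts T S"
    have H: "simple_graph ?H"
      using T by (auto simp: simple_graph_def remove_verts_def)
    have "finite (t -` S)" using S inj by (intro finite_vimageI) auto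
    then obtain m where m: "\<And>i. t i \<in> S \<Longrightarrow> i < m"
      using finite_nat_set_iff_bounded[of "t -` S"] by auto
    let ?C = "component_of ?H (t m)"
    have tm: "t m \<in> verts ?H" using m[of m] tT by (auto simp: remove_verts_def)
    have "(adj ?H)\<^sup>*\<^sup>* (t m) (t (m + j))" for j
    proof (induction j)
      case (Suc j)
      have "adj ?H (t (m + j)) (t (Suc (m + j)))"
        using adj[of "m + j"] m[of "m + j"] m[of "Suc (m + j)"] by (auto simp: adj_def remove_verts_def)
      with Suc show ?case by simp
    qed simp
    then have C: "t i \<in> verts ?C" if "m \<le> i" for i
      using tm that by (auto simp: component_of_def reachable_iff[OF H] le_iff_add)
    have ev: "\<exists>N. \<forall>n\<ge>N. q n \<in> verts ?C" if q: "ray T q" for q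
    proof -
      \<comment> \<open>Outside this finite set all vertices lie on the tail of \<open>t\<close>
        beyond \<open>S\<close>.\<close>
      let ?X = "(verts T - range t) \<union> t ` {..<m}"
      have "finite (q -` ?X)" using fin q by (intro finite_vimageI) (auto simp: ray_def)
      then obtain N where N: "\<And>n. q n \<in> ?X \<Longrightarrow> n < N"
        unfolding finite_nat_set_iff_bounded by blast
      have "q n \<in> verts ?C" if "N \<le> n" for n
      proof -
        have "q n \<notin> ?X" using N[of n] that by auto
        moreover have "q n \<in> verts T" using q by (auto simp: ray_def)
        ultimately obtain i where "q n = t i" "\<not> i < m" by auto
        then show ?thesis using C[of i] by simp
      qed
      then show ?thesis by blast
    qed
    obtain N1 N2 where "\<forall>n\<ge>N1. r n \<in> verts ?C" "\<forall>n\<ge>N2. s n \<in> verts ?C"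
      using ev[OF rs(1)] ev[OF rs(2)] by blast
    then have "\<forall>n\<ge>max N1 N2. r n \<in> verts ?C \<and> s n \<in> verts ?C" by simp
    moreover have "?C \<in> graph_components ?H" using tm by (simp add: graph_components_def)
    ultimately show "\<exists>C\<in>graph_components ?H. \<exists>N. \<forall>n\<ge>N. r n \<in> verts C \<and> s n \<in> verts C"
      by blast
  qed
  then have "graph_ends T = {{r. ray T r}}"
    using t by (auto simp: graph_ends_def quotient_def)
  then show ?thesis by (auto simp: one_ended_def)
qed

lemma tree_without_double_ray:
  assumes T: "simple_graph T" "connected_graph T" "\<nexists>c. is_cycle T c"
    and fin: "\<And>x. finite (nbhd T x)" and inf: "infinite (verts T)"
    and B: "finite (branch_verts T)"
    and no_double: "\<nexists>f :: int \<Rightarrow> 'a. inj f \<and> (\<forall>i. adj T (f i) (f (i + 1)))"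
  shows "finite_tree_with_ray (T :: 'a graph) \<and> one_ended T"
proof -
  obtain v where "v \<in> verts T" using inf by fastforce
  then obtain r where r: "ray T r"
    using infinite_graph_has_ray[OF T(1,2) fin inf] by blast
  then have rinj: "inj r" and rT: "\<And>i. r i \<in> verts T" and radj: "\<And>i. adj T (r i) (r (Suc i))"
    by (auto simp: ray_def)
  have "finite (r -` branch_verts T)" using B rinj by (intro finite_vimageI) auto
  then obtain M where M: "\<And>i. r i \<in> branch_verts T \<Longrightarrow> i < M"
    using finite_nat_set_iff_bounded[of "r -` branch_verts T"] by auto
  \<comment> \<open>The tail starts one step after \<open>r M\<close>, which remains as the
    attaching vertex \<open>k\<close>.\<close>
  define t where "t i = r (Suc M + i)" for i
  define k where "k = r M"
  have inj: "inj t" by (rule injI) (simp add: t_def inj_eq[OF rinj])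
  have tT: "t i \<in> verts T" for i using rT by (simp add: t_def)
  have tadj: "adj T (t i) (t (Suc i))" for i using radj by (simp add: t_def)
  have kt: "adj T k (t 0)" using radj by (simp add: k_def t_def)
  have k: "k \<in> verts T" "k \<notin> range t" using rT rinj by (auto simp: k_def t_def inj_eq)
  have nb: "nbhd T (t i) = {case i of 0 \<Rightarrow> k | Suc j \<Rightarrow> t j, t (Suc i)}" for i
  proof -
    have "t i \<notin> branch_verts T" using M by (fastforce simp: t_def)
    moreover have "(case i of 0 \<Rightarrow> k | Suc j \<Rightarrow> t j) \<in> nbhd T (t i)"
      using kt tadj by (auto simp: nbhd_def adj_commute split: nat.split)
    moreover have "t (Suc i) \<in> nbhd T (t i)" using tadj by (simp add: nbhd_def)
    moreover have "(case i of 0 \<Rightarrow> k | Suc j \<Rightarrow> t j) \<noteq> t (Suc i)"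
      using k(2) inj by (auto simp: inj_eq split: nat.split)
    ultimately show ?thesis by (rule degree_two_nbhd[OF fin tT])
  qed
  define K where "K = \<lparr>verts = verts T - range t, edges = {e \<in> edges T. e \<subseteq> verts T - range t}\<rparr>"
  have K: "simple_graph K" using T(1) by (auto simp: simple_graph_def K_def)
  have kK: "k \<in> verts K" using k by (simp add: K_def)
  have adjK: "adj K u v \<longleftrightarrow> adj T u v \<and> u \<notin> range t \<and> v \<notin> range t" for u v
    using simple_graph_adjD[OF T(1), of u v] by (auto simp: K_def adj_def)
  have Kconn: "(adj K)\<^sup>*\<^sup>* k x" if "x \<in> verts K" for x
  proof -
    \<comment> \<open>The only edge leaving the tail ends in \<open>k\<close>, so this set is closed
      under adjacency.\<close>
    let ?A = "{x. (adj K)\<^sup>*\<^sup>* k x} \<union> range t"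
    have "v \<in> ?A" if u: "u \<in> ?A" and uv: "adj T u v" for u v
    proof (cases "u \<in> range t")
      case True
      then obtain i where "u = t i" by auto
      then have "v \<in> {case i of 0 \<Rightarrow> k | Suc j \<Rightarrow> t j, t (Suc i)}" using nb uv by (auto simp: nbhd_def)
      then show ?thesis by (auto split: nat.splits)
    next
      case False
      then show ?thesis using u uv adjK by (auto intro: rtranclp.rtrancl_into_rtrancl)
    qed
    then have "verts T \<subseteq> ?A"
      using k(1) by (intro connected_graph_closed[OF T(1,2), of k]) auto
    then show ?thesis using that by (auto simp: K_def)
  qed
  have conK: "connected_graph K" using connected_graphI[OF K kK Kconn] .
  have finK: "finite (verts K)"
  proof (rule ccontr)
    assume "infinite (verts K)"
    moreover have "finite (nbhd K x)" for x
      using fin[of x] by (rule finite_subset[rotated]) (auto simp: nbhd_def adjK)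
    ultimately obtain s where s: "ray K s" "s 0 = k"
      using infinite_graph_has_ray[OF K conK _ _ kK] by blast
    have sinj: "inj s" and sK: "\<And>i. s i \<notin> range t" and sadj: "\<And>i. adj T (s i) (s (Suc i))"
      using s by (auto simp: ray_def adjK)
    \<comment> \<open>Traverse \<open>t\<close> backwards on the negative integers, with
      \<open>f (-1) = t 0\<close>, and continue with \<open>s\<close> from
      \<open>s 0 = k\<close>.\<close>
    define f where "f i = (if 0 \<le> i then s (nat i) else t (nat (- i) - 1))" for i :: int
    have "inj f"
    proof (rule injI)
      fix a b assume ab: "f a = f b"
      have "s p \<noteq> t q" for p q using sK[of p] by auto
      then show "a = b"
        using ab sinj inj by (auto simp: f_def inj_eq split: if_splits dest: sym)
    qed
    moreover have "adj T (f i) (f (i + 1))" for i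
    proof -
      consider "0 \<le> i" | "i = -1" | "i \<le> -2" by linarith
      then show ?thesis
      proof cases
        case 1 then show ?thesis using sadj[of "nat i"] by (simp add: f_def nat_add_distrib)
      next
        case 2 then show ?thesis using kt s(2) by (simp add: f_def adj_commute)
      next
        case 3
        then have "nat (- i) - 1 = Suc (nat (- (i + 1)) - 1)" by linarith
        then show ?thesis using 3 tadj[of "nat (- (i + 1)) - 1"] by (simp add: f_def adj_commute)
      qed
    qed
    ultimately show False using no_double by blast
  qed
  have treeK: "is_tree K"
  proof -
    have "is_cycle T c" if "is_cycle K c" for c using that by (auto simp: is_cycle_def adjK)
    then show ?thesis using K conK T(3) by (auto simp: is_tree_def)
  qed
  have edges: "edges T = edges K \<union> {{k, t 0}} \<union> {{t i, t (Suc i)} | i. True}"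
  proof
    show "edges T \<subseteq> edges K \<union> {{k, t 0}} \<union> {{t i, t (Suc i)} | i. True}"
    proof
      fix e assume "e \<in> edges T"
      then obtain u v where e: "e = {u, v}" "adj T u v" using simple_graph_edgeE[OF T(1)] by metis
      have tail: "{t i, x} \<in> {{k, t 0}} \<union> {{t i, t (Suc i)} | i. True}" if "adj T (t i) x" for i x
      proof -
        have "x \<in> {case i of 0 \<Rightarrow> k | Suc j \<Rightarrow> t j, t (Suc i)}" using nb that by (auto simp: nbhd_def)
        then show ?thesis by (cases i) (auto simp: insert_commute)
      qed
      consider i where "u = t i" | i where "v = t i" | "u \<notin> range t" "v \<notin> range t" by blast
      then show "e \<in> edges K \<union> {{k, t 0}} \<union> {{t i, t (Suc i)} | i. True}"
      proof cases
        case 1 then show ?thesis using tail e by blast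
      next
        case (2 i)
        then have "{t i, u} \<in> {{k, t 0}} \<union> {{t i, t (Suc i)} | i. True}"
          using tail[of i u] e(2) adj_commute[of T u v] by simp
        moreover have "e = {t i, u}" using 2 e(1) by (simp add: insert_commute)
        ultimately show ?thesis by blast
      next
        case 3 then show ?thesis using e adjK[of u v] by (auto simp: adj_def)
      qed
    qed
    show "edges K \<union> {{k, t 0}} \<union> {{t i, t (Suc i)} | i. True} \<subseteq> edges T"
      using kt tadj by (auto simp: K_def adj_def)
  qed
  have rayt: "ray T t" using inj tT tadj by (auto simp: ray_def)
  have "vertex_degree T (t i) = 2" for i
  proof -
    have "(case i of 0 \<Rightarrow> k | Suc j \<Rightarrow> t j) \<noteq> t (Suc i)"
      using k(2) inj by (auto simp: inj_eq split: nat.split)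
    then show ?thesis by (simp add: vertex_degree_def nb)
  qed
  then have "degree_two_ray T t" using rayt by (simp add: degree_two_ray_def)
  moreover have "verts K \<inter> range t = {}" "verts T = verts K \<union> range t"
    using tT by (auto simp: K_def)
  ultimately have "finite_tree_with_ray T"
    unfolding finite_tree_with_ray_def using treeK finK kK inj edges by blast
  moreover have "one_ended T"
    using one_endedI[OF T(1) rayt] finK by (simp add: K_def)
  ultimately show ?thesis by simp
qed

section \<open>From distortion to normalised weights, and the final assembly\<close>

text \<open>Finite distortion turns the extended supremum and infimum into positive reals, which are
  \<open>M\<close> and \<open>m\<close>.\<close>

lemma distortion_bounds:
  assumes ne: "edges G \<noteq> {}" and pos: "\<forall>e\<in>edges G. w e > 0" and fin: "distortion G w < \<infinity>"
  obtains m M where "0 < m" "m \<le> M" "\<And>e. e \<in> edges G \<Longrightarrow> m \<le> w e \<and> w e \<le> M"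
    "distortion G w = ereal (M / m)"
proof -
  define S where "S = (SUP e\<in>edges G. ereal (w e))"
  define I where "I = (INF e\<in>edges G. ereal (w e))"
  have dist: "distortion G w = (if S = \<infinity> \<or> I = 0 then \<infinity> else S / I)"
    by (simp add: distortion_def S_def I_def Let_def)
  then have SI: "S \<noteq> \<infinity>" "I \<noteq> 0" using fin by auto
  have le: "I \<le> ereal (w e)" "ereal (w e) \<le> S" if "e \<in> edges G" for e
    unfolding S_def I_def using that by (auto intro: INF_lower SUP_upper)
  obtain e where e: "e \<in> edges G" using ne by blast
  have "0 \<le> I" unfolding I_def by (rule INF_greatest) (use pos in \<open>auto intro: less_imp_le\<close>)
  then obtain m where m: "I = ereal m" "0 < m"
    using SI(2) le(1)[OF e] by (cases I) auto
  obtain M where M: "S = ereal M" using SI(1) le(2)[OF e] by (cases S) auto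
  show ?thesis
  proof (rule that[of m M])
    show "m \<le> M" using le[OF e] m M by simp
    show "m \<le> w e \<and> w e \<le> M" if "e \<in> edges G" for e using le[OF that] m M by simp
    show "distortion G w = ereal (M / m)" using dist SI m M by simp
  qed (rule m)
qed

text \<open>The product inequality is homogeneous of degree two, so it survives division by
  \<open>m\<close>.\<close>

lemma tree_like_weight_scaled:
  assumes G: "simple_graph G" "connected_graph G" "locally_finite G" and w: "admissible G w"
    and m: "0 < m" "\<And>e. e \<in> edges G \<Longrightarrow> m \<le> w e"
  shows "tree_like_weight G (\<lambda>e. w e / m)"
proof
  fix x y assume tl: "tree_like G {x, y}"
  have d: "wdegree G (\<lambda>e. w e / m) z = wdegree G w z / m" for z
    by (simp add: wdegree_def sum_divide_distrib)
  have "(wdegree G w x - w {x, y}) * (wdegree G w y - w {x, y}) / (m * m) \<le> (w {x, y})\<^sup>2 / (m * m)"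
    using admissible_tree_like[OF G tl w] m by (intro divide_right_mono) auto
  then show "(wdegree G (\<lambda>e. w e / m) x - w {x, y} / m) * (wdegree G (\<lambda>e. w e / m) y - w {x, y} / m)
      \<le> (w {x, y} / m)\<^sup>2"
    by (simp add: d diff_divide_distrib[symmetric] power2_eq_square)
qed (use assms in auto)

theorem corollary6p5:
  fixes G :: "'a graph"
  assumes "simple_graph G" and "connected_graph G" and "locally_finite G"
    and "DN_LLY G < \<infinity>"
    and "\<forall>n\<ge>6. \<not> graph_iso G (cycle_graph n)"
  shows "\<forall>T\<in>graph_components (tree_like_subgraph G). nontrivial T \<longrightarrow>
           finite (branch_verts T) \<and>
           int (card (branch_verts T)) \<le> \<lceil>real_of_ereal (DN_LLY G)\<rceil> \<and>
           (infinite (verts T) \<longrightarrow>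
              is_double_ray T \<or> (is_tree T \<and> one_ended T \<and> finite_tree_with_ray T))"
proof (intro ballI impI)
  note G = assms(1-3)
  let ?F = "tree_like_subgraph G"
  fix T assume "T \<in> graph_components ?F" and "nontrivial T"
  then obtain x where x: "x \<in> verts ?F" and T: "T = component_of ?F x"
    by (auto simp: graph_components_def)
  have ne: "edges G \<noteq> {}"
    using \<open>nontrivial T\<close> by (auto simp: T nontrivial_def component_of_def tree_like_subgraph_def tree_like_def)
  have pos: "\<forall>e\<in>edges G. w e > 0" if "admissible G w" for w
    using that by (simp add: admissible_def)
  have DN: "DN_LLY G = (INF w\<in>{w. admissible G w}. distortion G w)"
    using ne by (simp add: DN_LLY_def)
  then obtain w where w: "admissible G w" "distortion G w < \<infinity>"
    using assms(4) unfolding DN INF_less_iff by blast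
  obtain m M where mM: "0 < m" "\<And>e. e \<in> edges G \<Longrightarrow> m \<le> w e \<and> w e \<le> M"
    using distortion_bounds[OF ne pos[OF w(1)] w(2)] by metis
  \<comment> \<open>This fixed weight serves for the structure of \<open>T\<close>; the count
    interprets the locale again for each admissible weight with bounds.\<close>
  interpret tree_like_weight G "\<lambda>e. w e / m"
    using tree_like_weight_scaled[OF G w(1) mM(1)] mM(2) by blast
  have simT: "simple_graph T" and conT: "connected_graph T"
    unfolding T using simple_component_of[OF F_simple] connected_component_of[OF F_simple x] by auto
  have adjT: "adj T u v \<longleftrightarrow> adj ?F u v" if "u \<in> verts T" for u v
    using adj_component_of[OF F_simple] that by (simp add: T)
  have adjF: "adj ?F u v" if "adj T u v" for u v
    using adjT simple_graph_adjD(1)[OF simT that] that by blast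
  have NT: "nbhd T u \<subseteq> N u" for u
    using adjF F_N by (auto simp: nbhd_def)
  then have finT: "finite (nbhd T u)" for u by (meson fin_N finite_subset)
  have deg3: "3 \<le> card (N b)" if "b \<in> branch_verts T" for b
  proof -
    have "3 \<le> card (nbhd T b)" using that by (simp add: branch_verts_def vertex_degree_def)
    also have "\<dots> \<le> card (N b)" using NT by (intro card_mono) auto
    finally show ?thesis .
  qed
  \<comment> \<open>Stated for finite \<open>B\<close>, because finiteness of
    \<open>branch_verts T\<close> is itself deduced from the uniform bound.\<close>
  have bound: "real (card B) - 3 / 4 \<le> M' / m'"
    if B: "finite B" "B \<subseteq> branch_verts T" and w': "admissible G w'"
      and m': "0 < m'" "\<And>e. e \<in> edges G \<Longrightarrow> m' \<le> w' e \<and> w' e \<le> M'" for B w' m' M'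
  proof -
    interpret w': tree_like_weight G "\<lambda>e. w' e / m'"
      using tree_like_weight_scaled[OF G w' m'(1)] m'(2) by blast
    have "(adj ?F)\<^sup>*\<^sup>* x b" if "b \<in> B" for b
      using B that by (auto simp: T branch_verts_def component_of_def reachable_iff[OF F_simple])
    then obtain S where S: "finite S" "conn ?F S" "B \<subseteq> S"
      using finite_conn_superset[OF B(1)] by blast
    obtain e where "e \<in> edges G" using ne by blast
    then have "1 \<le> M' / m'" using m' by fastforce
    moreover have "w' e / m' \<le> M' / m'" if "e \<in> edges G" for e
      using m' that by (simp add: divide_right_mono)
    ultimately have "real (card B) \<le> M' / m' + 3 / 4"
      using w'.branch_bound[OF S(1,2,3), of "M' / m'"] deg3 B(2) by blast
    then show ?thesis by simp
  qed
  have "card B \<le> nat \<lceil>M / m + 1\<rceil>" if "B \<subseteq> branch_verts T" "finite B" for B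
    using bound[OF that(2,1) w(1) mM] by linarith
  then have finB: "finite (branch_verts T)"
    using finite_if_finite_subsets_card_bdd[of "branch_verts T"] by blast
  have "ereal (real (card (branch_verts T)) - 3 / 4) \<le> DN_LLY G"
    unfolding DN
  proof (rule INF_greatest)
    fix w' assume "w' \<in> {w. admissible G w}"
    then have w': "admissible G w'" by simp
    show "ereal (real (card (branch_verts T)) - 3 / 4) \<le> distortion G w'"
    proof (cases "distortion G w' < \<infinity>")
      case True
      then obtain m' M' where "0 < m'" "\<And>e. e \<in> edges G \<Longrightarrow> m' \<le> w' e \<and> w' e \<le> M'"
        "distortion G w' = ereal (M' / m')"
        using distortion_bounds[OF ne pos[OF w'] True] by metis
      then show ?thesis using bound[OF finB order_refl w'] by simp
    qed simp
  qed
  then have "real (card (branch_verts T)) - 3 / 4 \<le> real_of_ereal (DN_LLY G)"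
    using assms(4) by (cases "DN_LLY G") auto
  \<comment> \<open>An integer exceeding a real number by at most 3/4 is at most its
    ceiling.\<close>
  then have card: "int (card (branch_verts T)) \<le> \<lceil>real_of_ereal (DN_LLY G)\<rceil>" by linarith
  have acyc: "\<nexists>c. is_cycle T c"
  proof
    assume "\<exists>c. is_cycle T c"
    then obtain c where "is_cycle ?F c" using adjF by (auto simp: is_cycle_def)
    then show False using tree_like_cycle_iso[OF G(2)] assms(5) by blast
  qed
  have "is_double_ray T \<or> (is_tree T \<and> one_ended T \<and> finite_tree_with_ray T)" if inf: "infinite (verts T)"
  proof (cases "\<exists>f :: int \<Rightarrow> 'a. inj f \<and> (\<forall>i. adj T (f i) (f (i + 1)))")
    case False
    then show ?thesis
      using tree_without_double_ray[OF simT conT acyc finT inf finB] simT conT acyc by (simp add: is_tree_def)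
  next
    case True
    then obtain f :: "int \<Rightarrow> 'a" where f: "inj f" "\<And>i. adj T (f i) (f (i + 1))" by blast
    \<comment> \<open>By \<open>double_ray_N\<close> the vertices of the double ray have no further
      neighbours even in \<open>G\<close>, so its range is closed under adjacency.\<close>
    have nb: "v \<in> {f (i - 1), f (i + 1)}" if "adj T (f i) v" for i v
      using double_ray_N[of f i] f adjF NT[of "f i"] that by (auto simp: nbhd_def)
    have fT: "f i \<in> verts T" for i using simple_graph_adjD(1)[OF simT f(2)] .
    have "verts T \<subseteq> range f"
    proof (rule connected_graph_closed[OF simT conT])
      show "f 0 \<in> range f" "f 0 \<in> verts T" using fT by auto
      show "v \<in> range f" if "u \<in> range f" "adj T u v" for u v using nb that by blast
    qed
    then have verts: "verts T = range f" using fT by auto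
    have "edges T = {{f i, f (i + 1)} | i. True}"
    proof
      show "edges T \<subseteq> {{f i, f (i + 1)} | i. True}"
      proof
        fix e assume "e \<in> edges T"
        then obtain u v where e: "e = {u, v}" "adj T u v" using simple_graph_edgeE[OF simT] by metis
        then obtain i where i: "u = f i" using verts simple_graph_adjD(1)[OF simT] by blast
        then have "v = f (i - 1) \<or> v = f (i + 1)" using nb e by blast
        then show "e \<in> {{f i, f (i + 1)} | i. True}"
        proof
          assume "v = f (i - 1)"
          then have "e = {f (i - 1), f ((i - 1) + 1)}" using e i by auto
          then show ?thesis by blast
        qed (use e i in blast)
      qed
      show "{{f i, f (i + 1)} | i. True} \<subseteq> edges T" using f(2) by (auto simp: adj_def)
    qed
    then show ?thesis using f(1) verts by (auto simp: is_double_ray_def)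
  qed
  with finB card show "finite (branch_verts T) \<and>
      int (card (branch_verts T)) \<le> \<lceil>real_of_ereal (DN_LLY G)\<rceil> \<and>
      (infinite (verts T) \<longrightarrow>
         is_double_ray T \<or> (is_tree T \<and> one_ended T \<and> finite_tree_with_ray T))"
    by blast
qed

end
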